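(* Let $\langle S;\wedge\rangle$ be a finite meet semilattice of size $n=|S|>1$, and let $\mathrm{Con}(S;\wedge)$ denote its congruence lattice. Then the following hold. (i) $|\mathrm{Con}(S;\wedge)|\le 2^{n-1}=32\cdot 2^{n-6}$. Furthermore, $|\mathrm{Con}(S;\wedge)|=2^{n-1}$ if and only if $\langle S;\wedge\rangle$ is a tree semilattice. (ii) If $|\mathrm{Con}(S;\wedge)|<2^{n-1}=32\cdot 2^{n-6}$, then $|\mathrm{Con}(S;\wedge)|\le 28\cdot 2^{n-6}$. Furthermore, $|\mathrm{Con}(S;\wedge)|=28\cdot 2^{n-6}$ if and only if $\langle S;\wedge\rangle$ is a quasi-tree semilattice whose nucleus is (isomorphic to) the four-element boolean lattice. (iii) If $|\mathrm{Con}(S;\wedge)|<28\cdot 2^{n-6}$, then $|\mathrm{Con}(S;\wedge)|\le 26\cdot 2^{n-6}$. Furthermore, $|\mathrm{Con}(S;\wedge)|=26\cdot 2^{n-6}$ if and only if $\langle S;\wedge\rangle$ is a quasi-tree semilattice whose nucleus is (isomorphic to) the pentagon $N_5$. (iv) If $|\mathrm{Con}(S;\wedge)|<26\cdot 2^{n-6}$, then $|\mathrm{Con}(S;\wedge)|\le 25\cdot 2^{n-6}$. Furthermore, $|\mathrm{Con}(S;\wedge)|=25\cdot 2^{n-6}$ if and only if $\langle S;\wedge\rangle$ is a quasi-tree semilattice whose nucleus is (isomorphic to) either $F$ or $N_6$.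
   Context: A meet semilattice $\langle S;\wedge\rangle$ is ordered by $x\le y \iff x\wedge y=x$; $x\parallel y$ means that $x,y$ are incomparable. A finite meet semilattice has a least element $0$; put $S^{+}=S\setminus\{0\}$. Since $S$ is finite, two elements $a,b\in S^{+}$ with a common upper bound in $S$ have a least upper bound, denoted $a\vee b$ (a partial operation on $S^{+}$). $\langle S;\wedge\rangle$ is a tree semilattice if no two incomparable elements of $S$ have a common upper bound. The tree congruence $\boldsymbol\tau=\boldsymbol\tau(S;\wedge)$ of $\langle S;\wedge\rangle$ is the congruence (of the meet semilattice) generated by the set of pairs $\{\langle a\wedge b, a\vee b\rangle : a,b\in S^{+},\ a\parallel b,\ a\vee b \text{ exists}\}$. A quasi-tree semilattice is a finite meet semilattice whose tree congruence $\boldsymbol\tau$ has exactly one nonsingleton block; this unique nonsingleton block, regarded as a meet semilattice, is called its nucleus. Lattices named here are regarded as meet semilattices. The relevant meet semilattices are (each order being the reflexive-transitive closure of the listed relations): - the four-element boolean lattice $\{u,a,b,v\}$: $u<a<v$, $u<b<v$, $a\parallel b$; - $N_5=\{u,a,b,c,v\}$: $u<a<c<v$, $u<b<v$, with $b$ incomparable to $a$ and $c$; - $N_6=\{u,a_1,a_2,a_3,b,v\}$: $u<a_1<a_2<a_3<v$, $u<b<v$, with $b$ incomparable to $a_1,a_2,a_3$; - $F=\{u,a,b,c,v_1,v_2\}$: $u$ is the least element, $a,b,c$ are pairwise incomparable and cover $u$, $a<v_1$, $b<v_1$, $b<v_2$, $c<v_2$, $v_1\parallel v_2$, $a\not\le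 v_2$, $c\not\le v_1$ (so $v_1,v_2$ are maximal and $v_1\wedge v_2=b$). *)

theory Defs
  imports Complex_Main "HOL-Library.Cardinality"
begin

text \<open>
  A finite meet semilattice is a type \<open>'a\<close> of classes \<open>finite\<close> and \<open>semilattice_inf\<close>;
  its underlying set \<open>S\<close> is \<open>UNIV :: 'a set\<close> and its size is \<open>CARD('a)\<close>.
\<close>

subsection \<open>Congruences and tree semilattices\<close>

definition is_cong :: "('a::semilattice_inf \<times> 'a) set \<Rightarrow> bool" where
  "is_cong \<theta> \<longleftrightarrow> equiv UNIV \<theta> \<and>
     (\<forall>x x' y y'. (x, x') \<in> \<theta> \<longrightarrow> (y, y') \<in> \<theta> \<longrightarrow> (inf x y, inf x' y') \<in> \<theta>)"

definition Con :: "('a::semilattice_inf \<times> 'a) set set" where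
  "Con = {\<theta>. is_cong \<theta>}"

definition cong_generated :: "('a::semilattice_inf \<times> 'a) set \<Rightarrow> ('a \<times> 'a) set" where
  "cong_generated R = \<Inter>{\<theta> \<in> Con. R \<subseteq> \<theta>}"

definition incomparable :: "'a::order \<Rightarrow> 'a \<Rightarrow> bool" where
  "incomparable x y \<longleftrightarrow> \<not> x \<le> y \<and> \<not> y \<le> x"

definition tree_semilattice :: "'a::{finite,semilattice_inf} itself \<Rightarrow> bool" where
  "tree_semilattice _ \<longleftrightarrow> \<not> (\<exists>x y z :: 'a. incomparable x y \<and> x \<le> z \<and> y \<le> z)"


subsection \<open>The tree congruence\<close>

text \<open>\<open>Inf_fin UNIV\<close> is the least element \<open>0\<close>, so this is the set \<open>S\<^sup>+\<close> of nonzero elements.\<close>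

definition nonzero :: "'a::{finite,semilattice_inf} set" where
  "nonzero = UNIV - {Inf_fin UNIV}"

text \<open>Joins are partial, hence given as a relation: \<open>is_join a b c\<close> says that \<open>a \<or> b\<close> exists
  and equals \<open>c\<close>.\<close>

definition is_join :: "'a::order \<Rightarrow> 'a \<Rightarrow> 'a \<Rightarrow> bool" where
  "is_join a b c \<longleftrightarrow> a \<le> c \<and> b \<le> c \<and> (\<forall>d. a \<le> d \<longrightarrow> b \<le> d \<longrightarrow> c \<le> d)"

definition tree_cong :: "('a::{finite,semilattice_inf} \<times> 'a) set" where
  "tree_cong = cong_generated
     {(inf a b, c) | a b c. a \<in> nonzero \<and> b \<in> nonzero \<and> incomparable a b \<and> is_join a b c}"

definition nonsingleton_block :: "'a::{finite,semilattice_inf} set \<Rightarrow> bool" where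
  "nonsingleton_block B \<longleftrightarrow> B \<in> UNIV // tree_cong \<and> \<not> is_singleton B"

definition quasi_tree_semilattice :: "'a::{finite,semilattice_inf} itself \<Rightarrow> bool" where
  "quasi_tree_semilattice _ \<longleftrightarrow> (\<exists>!B :: 'a set. nonsingleton_block B)"

text \<open>Meaningful only if \<open>quasi_tree_semilattice TYPE('a)\<close> holds.\<close>

definition nucleus :: "'a::{finite,semilattice_inf} set" where
  "nucleus = (THE B. nonsingleton_block B)"

text \<open>The subset \<open>B\<close>, with the inherited meet operation, is isomorphic to the semilattice \<open>'b\<close>.\<close>

definition isomorphic_to :: "'a::semilattice_inf set \<Rightarrow> 'b::semilattice_inf itself \<Rightarrow> bool" where
  "isomorphic_to B _ \<longleftrightarrow> (\<exists>f :: 'a \<Rightarrow> 'b. bij_betw f B UNIV \<and>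
     (\<forall>x\<in>B. \<forall>y\<in>B. f (inf x y) = inf (f x) (f y)))"


subsection \<open>The named meet semilattices\<close>

text \<open>Each order is the reflexive-transitive closure of the listed pairs; that the given
  operation is the meet for this order is established by the instance proof.\<close>

lemma rtrancl_eqI:
  assumes "R \<subseteq> E" "trans E" "Id \<subseteq> E" "E \<subseteq> R\<^sup>*"
  shows "R\<^sup>* = E"
proof
  show "R\<^sup>* \<subseteq> E"
  proof safe
    fix x y assume "(x, y) \<in> R\<^sup>*"
    then show "(x, y) \<in> E"
      by induction (use assms in \<open>auto elim: transE\<close>)
  qed
qed (rule assms(4))

datatype bool4 = B4_u | B4_a | B4_b | B4_v

instantiation bool4 :: semilattice_inf
begin

definition less_eq_bool4 :: "bool4 \<Rightarrow> bool4 \<Rightarrow> bool" where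
  "(x::bool4) \<le> y \<longleftrightarrow> (x, y) \<in> {(B4_u, B4_a), (B4_a, B4_v), (B4_u, B4_b), (B4_b, B4_v)}\<^sup>*"

definition less_bool4 :: "bool4 \<Rightarrow> bool4 \<Rightarrow> bool" where
  "(x::bool4) < y \<longleftrightarrow> x \<le> y \<and> x \<noteq> y"

definition inf_bool4 :: "bool4 \<Rightarrow> bool4 \<Rightarrow> bool4" where
  "inf (x::bool4) y = (if x \<le> y then x else if y \<le> x then y else B4_u)"

lemma less_eq_bool4_iff: "(x::bool4) \<le> y \<longleftrightarrow> x = y \<or> x = B4_u \<or> y = B4_v"
proof -
  let ?R = "{(B4_u, B4_a), (B4_a, B4_v), (B4_u, B4_b), (B4_b, B4_v)}"
  have uv: "(B4_u, B4_v) \<in> ?R\<^sup>*"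
    by (rule rtrancl_trans[of _ B4_a]) (auto intro: r_into_rtrancl)
  have "?R\<^sup>* = {(x, y). x = y \<or> x = B4_u \<or> y = B4_v}"
  proof (rule rtrancl_eqI)
    show "{(x, y). x = y \<or> x = B4_u \<or> y = B4_v} \<subseteq> ?R\<^sup>*"
    proof clarify
      fix x y assume "x = y \<or> x = B4_u \<or> y = B4_v"
      then show "(x, y) \<in> ?R\<^sup>*"
        using uv by (cases x; cases y) (auto intro: r_into_rtrancl)
    qed
  qed (auto intro!: transI)
  then show ?thesis by (simp add: less_eq_bool4_def)
qed

instance
proof
  fix x y z :: bool4
  show "x < y \<longleftrightarrow> x \<le> y \<and> \<not> y \<le> x" "x \<le> x" "x \<le> y \<Longrightarrow> y \<le> z \<Longrightarrow> x \<le> z"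
    "x \<le> y \<Longrightarrow> y \<le> x \<Longrightarrow> x = y" "inf x y \<le> x" "inf x y \<le> y"
    "x \<le> y \<Longrightarrow> x \<le> z \<Longrightarrow> x \<le> inf y z"
    by (cases x; cases y; cases z; simp add: less_eq_bool4_iff less_bool4_def inf_bool4_def)+
qed

end

datatype pentagon = N5_u | N5_a | N5_b | N5_c | N5_v

instantiation pentagon :: semilattice_inf
begin

definition less_eq_pentagon :: "pentagon \<Rightarrow> pentagon \<Rightarrow> bool" where
  "(x::pentagon) \<le> y \<longleftrightarrow> (x, y) \<in>
     {(N5_u, N5_a), (N5_a, N5_c), (N5_c, N5_v), (N5_u, N5_b), (N5_b, N5_v)}\<^sup>*"

definition less_pentagon :: "pentagon \<Rightarrow> pentagon \<Rightarrow> bool" where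
  "(x::pentagon) < y \<longleftrightarrow> x \<le> y \<and> x \<noteq> y"

definition inf_pentagon :: "pentagon \<Rightarrow> pentagon \<Rightarrow> pentagon" where
  "inf (x::pentagon) y = (if x \<le> y then x else if y \<le> x then y else N5_u)"

lemma less_eq_pentagon_iff:
  "(x::pentagon) \<le> y \<longleftrightarrow> x = y \<or> x = N5_u \<or> y = N5_v \<or> (x = N5_a \<and> y = N5_c)"
proof -
  let ?R = "{(N5_u, N5_a), (N5_a, N5_c), (N5_c, N5_v), (N5_u, N5_b), (N5_b, N5_v)}"
  have uc: "(N5_u, N5_c) \<in> ?R\<^sup>*"
    by (rule rtrancl_trans[of _ N5_a]) (auto intro: r_into_rtrancl)
  have av: "(N5_a, N5_v) \<in> ?R\<^sup>*"
    by (rule rtrancl_trans[of _ N5_c]) (auto intro: r_into_rtrancl)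
  have uv: "(N5_u, N5_v) \<in> ?R\<^sup>*"
    by (rule rtrancl_trans[of _ N5_b]) (auto intro: r_into_rtrancl)
  have "?R\<^sup>* = {(x, y). x = y \<or> x = N5_u \<or> y = N5_v \<or> (x = N5_a \<and> y = N5_c)}"
  proof (rule rtrancl_eqI)
    show "{(x, y). x = y \<or> x = N5_u \<or> y = N5_v \<or> (x = N5_a \<and> y = N5_c)} \<subseteq> ?R\<^sup>*"
    proof clarify
      fix x y assume "x = y \<or> x = N5_u \<or> y = N5_v \<or> (x = N5_a \<and> y = N5_c)"
      then show "(x, y) \<in> ?R\<^sup>*"
        using uc av uv by (cases x; cases y) (auto intro: r_into_rtrancl)
    qed
  qed (auto intro!: transI)
  then show ?thesis by (simp add: less_eq_pentagon_def)
qed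

instance
proof
  fix x y z :: pentagon
  show "x < y \<longleftrightarrow> x \<le> y \<and> \<not> y \<le> x" "x \<le> x" "x \<le> y \<Longrightarrow> y \<le> z \<Longrightarrow> x \<le> z"
    "x \<le> y \<Longrightarrow> y \<le> x \<Longrightarrow> x = y" "inf x y \<le> x" "inf x y \<le> y"
    "x \<le> y \<Longrightarrow> x \<le> z \<Longrightarrow> x \<le> inf y z"
    by (cases x; cases y; cases z; simp add: less_eq_pentagon_iff less_pentagon_def inf_pentagon_def)+
qed

end

datatype hexagon = N6_u | N6_a1 | N6_a2 | N6_a3 | N6_b | N6_v

instantiation hexagon :: semilattice_inf
begin

definition less_eq_hexagon :: "hexagon \<Rightarrow> hexagon \<Rightarrow> bool" where
  "(x::hexagon) \<le> y \<longleftrightarrow> (x, y) \<in> {(N6_u, N6_a1), (N6_a1, N6_a2), (N6_a2, N6_a3), (N6_a3, N6_v),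
     (N6_u, N6_b), (N6_b, N6_v)}\<^sup>*"

definition less_hexagon :: "hexagon \<Rightarrow> hexagon \<Rightarrow> bool" where
  "(x::hexagon) < y \<longleftrightarrow> x \<le> y \<and> x \<noteq> y"

definition inf_hexagon :: "hexagon \<Rightarrow> hexagon \<Rightarrow> hexagon" where
  "inf (x::hexagon) y = (if x \<le> y then x else if y \<le> x then y else N6_u)"

lemma less_eq_hexagon_iff:
  "(x::hexagon) \<le> y \<longleftrightarrow> x = y \<or> x = N6_u \<or> y = N6_v \<or>
     (x = N6_a1 \<and> (y = N6_a2 \<or> y = N6_a3)) \<or> (x = N6_a2 \<and> y = N6_a3)"
proof -
  let ?R = "{(N6_u, N6_a1), (N6_a1, N6_a2), (N6_a2, N6_a3), (N6_a3, N6_v),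
    (N6_u, N6_b), (N6_b, N6_v)}"
  have u2: "(N6_u, N6_a2) \<in> ?R\<^sup>*"
    by (rule rtrancl_trans[of _ N6_a1]) (auto intro: r_into_rtrancl)
  have u3: "(N6_u, N6_a3) \<in> ?R\<^sup>*"
    by (rule rtrancl_trans[OF u2]) (auto intro: r_into_rtrancl)
  have a13: "(N6_a1, N6_a3) \<in> ?R\<^sup>*"
    by (rule rtrancl_trans[of _ N6_a2]) (auto intro: r_into_rtrancl)
  have a1v: "(N6_a1, N6_v) \<in> ?R\<^sup>*"
    by (rule rtrancl_trans[OF a13]) (auto intro: r_into_rtrancl)
  have a2v: "(N6_a2, N6_v) \<in> ?R\<^sup>*"
    by (rule rtrancl_trans[of _ N6_a3]) (auto intro: r_into_rtrancl)
  have uv: "(N6_u, N6_v) \<in> ?R\<^sup>*"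
    by (rule rtrancl_trans[of _ N6_b]) (auto intro: r_into_rtrancl)
  have "?R\<^sup>* = {(x, y). x = y \<or> x = N6_u \<or> y = N6_v \<or>
     (x = N6_a1 \<and> (y = N6_a2 \<or> y = N6_a3)) \<or> (x = N6_a2 \<and> y = N6_a3)}"
    (is "_ = ?E")
  proof (rule rtrancl_eqI)
    show "?E \<subseteq> ?R\<^sup>*"
    proof clarify
      fix x y assume "x = y \<or> x = N6_u \<or> y = N6_v \<or>
        (x = N6_a1 \<and> (y = N6_a2 \<or> y = N6_a3)) \<or> (x = N6_a2 \<and> y = N6_a3)"
      then show "(x, y) \<in> ?R\<^sup>*"
        using u2 u3 a13 a1v a2v uv by (cases x; cases y) (auto intro: r_into_rtrancl)
    qed
  qed (auto intro!: transI)
  then show ?thesis by (simp add: less_eq_hexagon_def)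
qed

instance
proof
  fix x y z :: hexagon
  show "x < y \<longleftrightarrow> x \<le> y \<and> \<not> y \<le> x" "x \<le> x" "x \<le> y \<Longrightarrow> y \<le> z \<Longrightarrow> x \<le> z"
    "x \<le> y \<Longrightarrow> y \<le> x \<Longrightarrow> x = y" "inf x y \<le> x" "inf x y \<le> y"
    "x \<le> y \<Longrightarrow> x \<le> z \<Longrightarrow> x \<le> inf y z"
    by (cases x; cases y; cases z; simp add: less_eq_hexagon_iff less_hexagon_def inf_hexagon_def)+
qed

end

datatype semilattice_F = F_u | F_a | F_b | F_c | F_v1 | F_v2

instantiation semilattice_F :: semilattice_inf
begin

definition less_eq_semilattice_F :: "semilattice_F \<Rightarrow> semilattice_F \<Rightarrow> bool" where
  "(x::semilattice_F) \<le> y \<longleftrightarrow> (x, y) \<in> {(F_u, F_a), (F_u, F_b), (F_u, F_c),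
     (F_a, F_v1), (F_b, F_v1), (F_b, F_v2), (F_c, F_v2)}\<^sup>*"

definition less_semilattice_F :: "semilattice_F \<Rightarrow> semilattice_F \<Rightarrow> bool" where
  "(x::semilattice_F) < y \<longleftrightarrow> x \<le> y \<and> x \<noteq> y"

definition inf_semilattice_F :: "semilattice_F \<Rightarrow> semilattice_F \<Rightarrow> semilattice_F" where
  "inf (x::semilattice_F) y = (if x \<le> y then x else if y \<le> x then y
     else if {x, y} = {F_v1, F_v2} then F_b else F_u)"

lemma less_eq_semilattice_F_iff:
  "(x::semilattice_F) \<le> y \<longleftrightarrow> x = y \<or> x = F_u \<or>
     (y = F_v1 \<and> (x = F_a \<or> x = F_b)) \<or> (y = F_v2 \<and> (x = F_b \<or> x = F_c))"
proof -
  let ?R = "{(F_u, F_a), (F_u, F_b), (F_u, F_c),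
     (F_a, F_v1), (F_b, F_v1), (F_b, F_v2), (F_c, F_v2)}"
  have uv1: "(F_u, F_v1) \<in> ?R\<^sup>*"
    by (rule rtrancl_trans[of _ F_b]) (auto intro: r_into_rtrancl)
  have uv2: "(F_u, F_v2) \<in> ?R\<^sup>*"
    by (rule rtrancl_trans[of _ F_b]) (auto intro: r_into_rtrancl)
  have "?R\<^sup>* = {(x, y). x = y \<or> x = F_u \<or>
     (y = F_v1 \<and> (x = F_a \<or> x = F_b)) \<or> (y = F_v2 \<and> (x = F_b \<or> x = F_c))}"
    (is "_ = ?E")
  proof (rule rtrancl_eqI)
    show "?E \<subseteq> ?R\<^sup>*"
    proof clarify
      fix x y assume "x = y \<or> x = F_u \<or>
        (y = F_v1 \<and> (x = F_a \<or> x = F_b)) \<or> (y = F_v2 \<and> (x = F_b \<or> x = F_c))"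
      then show "(x, y) \<in> ?R\<^sup>*"
        using uv1 uv2 by (cases x; cases y) (auto intro: r_into_rtrancl)
    qed
  qed (auto intro!: transI)
  then show ?thesis by (simp add: less_eq_semilattice_F_def)
qed

instance
proof
  fix x y z :: semilattice_F
  show "x < y \<longleftrightarrow> x \<le> y \<and> \<not> y \<le> x" "x \<le> x" "x \<le> y \<Longrightarrow> y \<le> z \<Longrightarrow> x \<le> z"
    "x \<le> y \<Longrightarrow> y \<le> x \<Longrightarrow> x = y" "inf x y \<le> x" "inf x y \<le> y"
    "x \<le> y \<Longrightarrow> x \<le> z \<Longrightarrow> x \<le> inf y z"
    by (cases x; cases y; cases z;
        simp add: less_eq_semilattice_F_iff less_semilattice_F_def inf_semilattice_F_def
          doubleton_eq_iff)+
qed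

end

end

theory Submission
  imports Defs
begin

text \<open>
  A congruence of a finite meet semilattice is determined by the set \<open>M\<close> of least elements of its
  blocks: \<open>x\<close> and \<open>y\<close> are congruent iff the same elements of \<open>M\<close> lie below them.  The sets \<open>M\<close>
  that occur are exactly those that contain \<open>0\<close> and are closed under all existing joins
  (\<open>block_minima_same_below\<close>, \<open>same_below_block_minima\<close>).  As \<open>0\<close> occurs in no join of
  incomparable elements, the number of congruences divided by \<open>2^(n - 1)\<close> is the probability that a
  random subset of the semilattice is join-closed (\<open>card_Con_share\<close>).  So every incomparable pair with
  an upper bound, below called a \<^emph>\<open>bounded pair\<close>, costs something, and the whole theorem is about
  the few ways to have so few bounded pairs that this probability is at least \<open>25/32\<close>.

  Each bounded pair forbids the subsets that contain the pair but not its join.  Without bounded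
  pairs the probability is \<open>1\<close>, with one it is \<open>7/8 = 28/32\<close>.  Two bounded pairs that share an
  element leave \<open>26/32\<close> if their joins agree and \<open>25/32\<close> if they differ; three that share an
  element and have the same join leave \<open>25/32\<close>.  Every other configuration falls below \<open>25/32\<close>:
  two disjoint pairs always do, as does a triangle, and so does a further pair in addition to a
  configuration that has reached \<open>25/32\<close>, since that pair on its own is an admissible set that is not
  join-closed.  This is \<open>joins_shape\<close>.

  What remains is to compare such a configuration with the nucleus.  The least elements of the
  blocks of the tree congruence are precisely the elements that occur in no bounded pair and are not
  the join of one (\<open>tree_cong_eq\<close>).  Hence, for each named \<open>N\<close>, being a quasi-tree
  semilattice with nucleus \<open>N\<close> means having an embedding of \<open>N\<close> that carries the bounded pairs of
  \<open>N\<close>, with their joins, onto all those of the semilattice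
  (\<open>joins_embedding_of_nucleus\<close>, \<open>nucleus_of_joins_embedding\<close>).  In one direction this
  reads the probability off \<open>N\<close>; in the other, the configurations found above determine all meets
  of their elements and so provide embeddings of the four named semilattices.
\<close>

section \<open>Joins of incomparable pairs\<close>

text \<open>
  Comparable elements are left out: their join is the larger one, so they put no condition on a
  join-closed set.
\<close>

definition joins :: "('a::order \<times> 'a \<times> 'a) set" where
  "joins = {(a, b, c). incomparable a b \<and> is_join a b c}"

definition join_closed :: "'a::order set \<Rightarrow> bool" where
  "join_closed X \<longleftrightarrow> (\<forall>(a, b, c) \<in> joins. a \<in> X \<longrightarrow> b \<in> X \<longrightarrow> c \<in> X)"

lemma join_closedD: "join_closed X \<Longrightarrow> (a, b, c) \<in> joins \<Longrightarrow> a \<in> X \<Longrightarrow> b \<in> X \<Longrightarrow> c \<in> X"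
  unfolding join_closed_def by blast

lemma joinsD:
  assumes "(a, b, c) \<in> joins"
  shows "\<not> a \<le> b" "\<not> b \<le> a" "a \<le> c" "b \<le> c" "a \<noteq> b" "c \<noteq> a" "c \<noteq> b"
    "a \<le> d \<Longrightarrow> b \<le> d \<Longrightarrow> c \<le> d"
  using assms by (auto simp: joins_def incomparable_def is_join_def)

lemma joins_commute: "(a, b, c) \<in> joins \<Longrightarrow> (b, a, c) \<in> joins"
  by (auto simp: joins_def incomparable_def is_join_def)

lemma joins_unique: "(a, b, c) \<in> joins \<Longrightarrow> (a, b, d) \<in> joins \<Longrightarrow> c = d"
  by (auto simp: joins_def is_join_def intro: order.antisym)

lemma bounded_incomparable_join:
  fixes a :: "'a::{finite,semilattice_inf}"
  assumes "\<not> a \<le> b" "\<not> b \<le> a" "a \<le> z" "b \<le> z"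
  obtains c where "(a, b, c) \<in> joins" "c \<le> z"
proof
  let ?Y = "{z. a \<le> z \<and> b \<le> z}"
  have "is_join a b (Inf_fin ?Y)"
    unfolding is_join_def using assms
    by (auto intro!: Inf_fin.boundedI Inf_fin.coboundedI)
  then show "(a, b, Inf_fin ?Y) \<in> joins"
    using assms by (simp add: joins_def incomparable_def)
  show "Inf_fin ?Y \<le> z"
    using assms by (auto intro!: Inf_fin.coboundedI)
qed

lemma bounded_comparable:
  fixes x y :: "'a::{finite,semilattice_inf}"
  assumes "x \<le> z" "y \<le> z" "\<And>c. (x, y, c) \<notin> joins"
  shows "x \<le> y \<or> y \<le> x"
  using assms bounded_incomparable_join by metis

lemma Inf_fin_UNIV_le: "Inf_fin UNIV \<le> (x::'a::{finite,semilattice_inf})"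
  by (simp add: Inf_fin.coboundedI)

lemma zero_notin_joins:
  fixes a b c :: "'a::{finite,semilattice_inf}"
  assumes "(a, b, c) \<in> joins"
  shows "a \<noteq> Inf_fin UNIV" "b \<noteq> Inf_fin UNIV" "c \<noteq> Inf_fin UNIV"
  using joinsD(1-4)[OF assms] Inf_fin_UNIV_le[of a] Inf_fin_UNIV_le[of b]
  by (auto intro: order.trans)

lemma tree_semilattice_iff_no_joins:
  "tree_semilattice TYPE('a::{finite,semilattice_inf}) \<longleftrightarrow> (joins :: ('a \<times> 'a \<times> 'a) set) = {}"
proof
  assume "tree_semilattice TYPE('a)"
  then show "(joins :: ('a \<times> 'a \<times> 'a) set) = {}"
    by (auto simp: tree_semilattice_def joins_def is_join_def)
next
  assume "(joins :: ('a \<times> 'a \<times> 'a) set) = {}"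
  then show "tree_semilattice TYPE('a)"
    unfolding tree_semilattice_def incomparable_def
    by (metis bounded_incomparable_join empty_iff)
qed


section \<open>Congruences as join-closed sets\<close>

definition block_minima :: "('a::order \<times> 'a) set \<Rightarrow> 'a set" where
  "block_minima \<theta> = {a. \<forall>x. (x, a) \<in> \<theta> \<longrightarrow> a \<le> x}"

definition same_below :: "'a::order set \<Rightarrow> ('a \<times> 'a) set" where
  "same_below M = {(x, y). \<forall>a\<in>M. a \<le> x \<longleftrightarrow> a \<le> y}"

lemma same_below_Con: "same_below M \<in> (Con :: ('a::semilattice_inf \<times> 'a) set set)"
  unfolding Con_def is_cong_def same_below_def equiv_def refl_on_def sym_def trans_def
  by simp

lemma same_below_antimono: "M \<subseteq> N \<Longrightarrow> same_below N \<subseteq> same_below M"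
  by (auto simp: same_below_def)

lemma ConD:
  assumes "\<theta> \<in> Con"
  shows "(x, x) \<in> \<theta>" "(x, y) \<in> \<theta> \<Longrightarrow> (y, x) \<in> \<theta>"
    "(x, y) \<in> \<theta> \<Longrightarrow> (y, z) \<in> \<theta> \<Longrightarrow> (x, z) \<in> \<theta>"
    "(x, x') \<in> \<theta> \<Longrightarrow> (y, y') \<in> \<theta> \<Longrightarrow> (inf x y, inf x' y') \<in> \<theta>"
  using assms unfolding Con_def is_cong_def equiv_def refl_on_def sym_def trans_def by blast+

text \<open>
  Meeting both sides of a congruent pair with \<open>a\<close> shows that the principal filter of a block minimum
  \<open>a\<close> is a union of blocks.
\<close>

lemma block_minima_saturated:
  assumes "\<theta> \<in> Con" "a \<in> block_minima \<theta>" "a \<le> x" "(x, y) \<in> \<theta>"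
  shows "a \<le> y"
proof -
  have "(inf a y, inf a x) \<in> \<theta>"
    using assms ConD[OF assms(1)] by blast
  then have "(inf a y, a) \<in> \<theta>"
    using assms by (simp add: inf_absorb1)
  then have "a \<le> inf a y"
    using assms(2) unfolding block_minima_def by blast
  then show ?thesis by simp
qed

lemma block_minimum_exists:
  fixes \<theta> :: "('a::{finite,semilattice_inf} \<times> 'a) set"
  assumes "\<theta> \<in> Con"
  obtains m where "m \<in> block_minima \<theta>" "m \<le> x" "(m, x) \<in> \<theta>"
proof -
  obtain m where m: "(m, x) \<in> \<theta>" and min: "\<And>y. (y, x) \<in> \<theta> \<Longrightarrow> y \<le> m \<Longrightarrow> y = m"
    using finite_has_minimal[of "{y. (y, x) \<in> \<theta>}"] ConD(1)[OF assms] by fastforce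
  have least: "m \<le> y" if "(y, x) \<in> \<theta>" for y
  proof -
    have "(inf m y, x) \<in> \<theta>"
      using ConD(4)[OF assms m that] by simp
    then have "inf m y = m" using min by simp
    then show ?thesis by (simp add: inf.absorb_iff1)
  qed
  show thesis
  proof
    show "m \<in> block_minima \<theta>"
      using least m ConD(3)[OF assms] by (auto simp: block_minima_def)
  qed (use m least ConD(1)[OF assms] in auto)
qed

text \<open>
  If the same block minima lie below \<open>x\<close> and \<open>y\<close>, then the least element of the block of \<open>x\<close> is
  below \<open>y\<close>, so meeting with \<open>y\<close> shows \<open>x\<close> congruent to \<open>inf x y\<close>; by symmetry so is \<open>y\<close>.
\<close>

lemma same_below_block_minima:
  fixes \<theta> :: "('a::{finite,semilattice_inf} \<times> 'a) set"
  assumes "\<theta> \<in> Con"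
  shows "same_below (block_minima \<theta>) = \<theta>"
proof
  show "\<theta> \<subseteq> same_below (block_minima \<theta>)"
    using block_minima_saturated[OF assms] ConD(2)[OF assms]
    by (auto simp: same_below_def)
  show "same_below (block_minima \<theta>) \<subseteq> \<theta>"
  proof clarify
    fix x y assume xy: "(x, y) \<in> same_below (block_minima \<theta>)"
    have half: "(z, inf z w) \<in> \<theta>" if zw: "(z, w) \<in> same_below (block_minima \<theta>)" for z w
    proof -
      obtain m where m: "m \<in> block_minima \<theta>" "m \<le> z" "(m, z) \<in> \<theta>"
        using block_minimum_exists[OF assms] by blast
      then have "m \<le> w" using zw by (auto simp: same_below_def)
      then have "(m, inf z w) \<in> \<theta>"
        using ConD(4)[OF assms m(3) ConD(1)[OF assms, of w]] by (simp add: inf_absorb1)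
      then show ?thesis using m ConD(2,3)[OF assms] by blast
    qed
    have "(x, inf x y) \<in> \<theta>" "(y, inf x y) \<in> \<theta>"
      using half[of x y] half[of y x] xy by (auto simp: same_below_def inf_commute)
    then show "(x, y) \<in> \<theta>" using ConD(2,3)[OF assms] by blast
  qed
qed

lemma join_closed_block_minima:
  assumes "\<theta> \<in> Con"
  shows "join_closed (block_minima \<theta>)"
  unfolding join_closed_def
proof clarify
  fix a b c assume j: "(a, b, c) \<in> joins" and ab: "a \<in> block_minima \<theta>" "b \<in> block_minima \<theta>"
  show "c \<in> block_minima \<theta>"
    unfolding block_minima_def
  proof clarify
    fix x assume "(x, c) \<in> \<theta>"
    then have "(c, x) \<in> \<theta>" using ConD(2)[OF assms] by blast
    then have "a \<le> x" "b \<le> x"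
      using block_minima_saturated[OF assms] ab joinsD(3,4)[OF j] by blast+
    then show "c \<le> x" using joinsD(8)[OF j] by blast
  qed
qed

text \<open>
  Join-closedness provides a greatest element \<open>m\<close> of \<open>M\<close> below any given \<open>a\<close>, and \<open>m\<close> is congruent
  to \<open>a\<close>.  The least element of the semilattice must be in \<open>M\<close> for there to be any candidate.
\<close>

lemma block_minima_same_below:
  fixes M :: "'a::{finite,semilattice_inf} set"
  assumes "join_closed M" "Inf_fin UNIV \<in> M"
  shows "block_minima (same_below M) = M"
proof
  show "M \<subseteq> block_minima (same_below M)"
    by (auto simp: block_minima_def same_below_def)
  show "block_minima (same_below M) \<subseteq> M"
  proof
    fix a assume a: "a \<in> block_minima (same_below M)"
    obtain m where m: "m \<in> M" "m \<le> a" and max: "\<And>y. y \<in> M \<Longrightarrow> y \<le> a \<Longrightarrow> m \<le> y \<Longrightarrow> y = m"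
      using finite_has_maximal[of "{y\<in>M. y \<le> a}"] assms(2) Inf_fin_UNIV_le by fastforce
    have "y \<le> m" if y: "y \<in> M" "y \<le> a" for y
    proof (rule ccontr)
      assume ym: "\<not> y \<le> m"
      then have "\<not> m \<le> y" using max[OF y] by auto
      with ym m y obtain c where c: "(y, m, c) \<in> joins" "c \<le> a"
        using bounded_incomparable_join by metis
      then have "c = m"
        using max[of c] join_closedD[OF assms(1) c(1)] m y joinsD(4)[OF c(1)] by blast
      then show False using joinsD(7)[OF c(1)] by simp
    qed
    then have "(m, a) \<in> same_below M"
      using m by (auto simp: same_below_def intro: order.trans)
    then have "a \<le> m" using a by (simp add: block_minima_def)
    then show "a \<in> M" using m by (simp add: order.antisym)
  qed
qed

lemma card_Con:
  "card (Con :: ('a::{finite,semilattice_inf} \<times> 'a) set set)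
     = card {M :: 'a set. join_closed M \<and> Inf_fin UNIV \<in> M}"
proof (rule bij_betw_same_card)
  show "bij_betw block_minima (Con :: ('a \<times> 'a) set set) {M. join_closed M \<and> Inf_fin UNIV \<in> M}"
  proof (rule bij_betw_byWitness[where f' = same_below])
    show "block_minima ` (Con :: ('a \<times> 'a) set set) \<subseteq> {M. join_closed M \<and> Inf_fin UNIV \<in> M}"
      using join_closed_block_minima Inf_fin_UNIV_le by (auto simp: block_minima_def)
  qed (auto simp: same_below_block_minima block_minima_same_below same_below_Con)
qed


section \<open>The share of join-closed subsets\<close>

text \<open>
  Working with the probability that a uniformly random subset satisfies \<open>P\<close>, instead of with
  cardinalities, makes the elements that \<open>P\<close> does not look at disappear from all computations.
\<close>

definition share :: "('a::finite set \<Rightarrow> bool) \<Rightarrow> real" where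
  "share P = card {X. P X} / 2 ^ CARD('a)"

lemma share_True: "share (\<lambda>X::'a::finite set. True) = 1"
  by (simp add: share_def card_UNIV_set flip: Pow_UNIV) (simp add: card_Pow)

lemma share_mono:
  assumes "\<And>X. P X \<Longrightarrow> Q X"
  shows "share P \<le> share Q"
  unfolding share_def by (intro divide_right_mono of_nat_mono card_mono) (use assms in auto)

lemma share_strict_mono:
  assumes "\<And>X. P X \<Longrightarrow> Q X" "Q Y" "\<not> P Y"
  shows "share P < share Q"
proof -
  have "card {X. P X} < card {X. Q X}"
    by (rule psubset_card_mono) (use assms in auto)
  then show ?thesis by (simp add: share_def divide_strict_right_mono)
qed

lemma card_sets_split:
  "card {X :: 'a::finite set. P X} = card {X. P X \<and> x \<in> X} + card {X. P X \<and> x \<notin> X}"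
  by (subst card_Un_disjoint[symmetric]) (auto intro: arg_cong[where f = card])

lemma card_sets_insert:
  "card {X :: 'a::finite set. P (insert x X)} = 2 * card {X. P X \<and> x \<in> X}"
proof -
  have "card {X. P (insert x X) \<and> x \<notin> X} = card {X. P X \<and> x \<in> X}"
    by (rule bij_betw_same_card[OF bij_betw_byWitness[where f = "insert x" and f' = "\<lambda>X. X - {x}"]])
      (auto simp: insert_absorb)
  moreover have "{X. P (insert x X) \<and> x \<in> X} = {X. P X \<and> x \<in> X}"
    by (auto simp: insert_absorb)
  ultimately show ?thesis
    by (subst card_sets_split[where x = x]) simp
qed

lemma card_sets_delete:
  "card {X :: 'a::finite set. P (X - {x})} = 2 * card {X. P X \<and> x \<notin> X}"
proof -
  have "card {X. P (X - {x}) \<and> x \<in> X} = card {X. P X \<and> x \<notin> X}"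
    by (rule bij_betw_same_card[OF bij_betw_byWitness[where f' = "insert x" and f = "\<lambda>X. X - {x}"]])
      (auto simp: insert_absorb)
  moreover have "{X. P (X - {x}) \<and> x \<notin> X} = {X. P X \<and> x \<notin> X}"
    by auto
  ultimately show ?thesis
    by (subst card_sets_split[where x = x]) simp
qed

lemma share_split:
  "share P = (share (\<lambda>X. P (insert x X)) + share (\<lambda>X. P (X - {x}))) / 2"
  unfolding share_def card_sets_insert card_sets_delete
  by (subst card_sets_split[where x = x]) (simp add: field_simps)

text \<open>
  The same probability for \<open>k\<close> independent fair coins.  It is defined by recursion so that rewriting
  evaluates it on concrete conditions.
\<close>

fun truth_share :: "nat \<Rightarrow> (bool list \<Rightarrow> bool) \<Rightarrow> real" where
  "truth_share 0 \<Phi> = of_bool (\<Phi> [])"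
| "truth_share (Suc k) \<Phi>
     = (truth_share k (\<lambda>bs. \<Phi> (True # bs)) + truth_share k (\<lambda>bs. \<Phi> (False # bs))) / 2"

lemma share_truth_share:
  assumes "distinct xs"
  shows "share (\<lambda>X. \<Phi> (map (\<lambda>x. x \<in> X) xs)) = truth_share (length xs) \<Phi>"
  using assms
proof (induction xs arbitrary: \<Phi>)
  case Nil
  show ?case using share_True[where 'a = 'a] by (cases "\<Phi> []") (simp_all add: share_def)
next
  case (Cons x xs)
  have *: "map (\<lambda>y. y \<in> insert x X) xs = map (\<lambda>y. y \<in> X) xs"
    "map (\<lambda>y. y \<in> X - {x}) xs = map (\<lambda>y. y \<in> X) xs" for X
    using Cons.prems by auto
  have "distinct xs" using Cons.prems by simp
  then have IH: "share (\<lambda>X. \<Phi> (b # map (\<lambda>x. x \<in> X) xs)) = truth_share (length xs) (\<lambda>bs. \<Phi> (b # bs))" for b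
    by (rule Cons.IH)
  show ?case
    by (subst share_split[where x = x]) (simp add: * IH del: insert_iff Diff_iff, simp add: IH)
qed

lemma share_join_closed_le:
  fixes xs :: "'a::{finite,order} list"
  assumes "distinct xs" "\<And>X. join_closed X \<Longrightarrow> \<Phi> (map (\<lambda>x. x \<in> X) xs)"
  shows "share (join_closed :: 'a set \<Rightarrow> bool) \<le> truth_share (length xs) \<Phi>"
  unfolding share_truth_share[OF assms(1), symmetric] using assms(2) by (rule share_mono)

text \<open>
  If an upper bound takes only some of the joins into account, a bounded pair that it ignores makes
  it strict: the set consisting of that pair alone is counted but is not join-closed.
\<close>

lemma share_join_closed_less:
  fixes xs :: "'a::{finite,order} list"
  assumes "distinct xs" "\<And>X. join_closed X \<Longrightarrow> \<Phi> (map (\<lambda>x. x \<in> X) xs)"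
    and j: "(p, q, r) \<in> joins" and "\<Phi> (map (\<lambda>x. x \<in> {p, q}) xs)"
  shows "share (join_closed :: 'a set \<Rightarrow> bool) < truth_share (length xs) \<Phi>"
proof -
  have "\<not> join_closed {p, q}"
    using join_closedD[OF _ j, of "{p, q}"] joinsD[OF j] by auto
  then show ?thesis
    unfolding share_truth_share[OF assms(1), symmetric]
    by (intro share_strict_mono[where Y = "{p, q}"]) (use assms(2,4) in auto)
qed

lemma share_join_closed_eq:
  fixes xs :: "'a::{finite,order} list"
  assumes "distinct xs" "\<And>X. join_closed X \<longleftrightarrow> \<Phi> (map (\<lambda>x. x \<in> X) xs)"
  shows "share (join_closed :: 'a set \<Rightarrow> bool) = truth_share (length xs) \<Phi>"
proof -
  have "(join_closed :: 'a set \<Rightarrow> bool) = (\<lambda>X. \<Phi> (map (\<lambda>x. x \<in> X) xs))" using assms(2) by (rule ext)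
  then show ?thesis using share_truth_share[OF assms(1), of \<Phi>] by simp
qed

text \<open>
  Congruences correspond to the join-closed sets that contain the least element of the semilattice.
  Since that element occurs in no join, these are exactly half of all join-closed sets; this is where
  the exponent drops by one.
\<close>

lemma card_Con_share:
  "real (card (Con :: ('a::{finite,semilattice_inf} \<times> 'a) set set))
     = share (join_closed :: 'a set \<Rightarrow> bool) * 2 ^ (CARD('a) - 1)"
proof -
  let ?o = "Inf_fin UNIV :: 'a"
  have free: "join_closed (insert ?o X) = join_closed X" for X
  proof -
    show ?thesis unfolding join_closed_def using zero_notin_joins by fastforce
  qed
  have "card {X :: 'a set. join_closed X} = 2 * card (Con :: ('a \<times> 'a) set set)"
    using card_sets_insert[of join_closed ?o] by (simp add: free card_Con)
  moreover have "(2::real) ^ CARD('a) = 2 * 2 ^ (CARD('a) - 1)"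
    by (cases "CARD('a)") simp_all
  ultimately show ?thesis by (simp add: share_def)
qed


section \<open>The tree congruence and its nucleus\<close>

definition core :: "'a::order set" where
  "core = (\<Union>(a, b, c)\<in>joins. {a, b, c})"

lemma core_iff: "x \<in> core \<longleftrightarrow> (\<exists>y z. (x, y, z) \<in> joins) \<or> (\<exists>a b. (a, b, x) \<in> joins)"
  unfolding core_def by (auto dest: joins_commute)

text \<open>
  An element \<open>m\<close> outside the core is comparable with everything that is bounded together with it.
  So if \<open>m\<close> is below the join of \<open>a\<close> and \<open>b\<close>, it is above both, hence equal to the join and in the
  core; or strictly between \<open>a\<close> and \<open>b\<close>, which are incomparable; or below both.
\<close>

lemma outside_core_below_join:
  fixes m :: "'a::{finite,semilattice_inf}"
  assumes "m \<notin> core" "(a, b, c) \<in> joins" "m \<le> c"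
  shows "m \<le> inf a b"
proof -
  have "m \<le> x \<or> x \<le> m" if "x \<le> c" for x
    using bounded_incomparable_join[OF _ _ assms(3) that] assms(1) unfolding core_iff by metis
  then have "m \<le> a \<or> a \<le> m" "m \<le> b \<or> b \<le> m"
    using joinsD[OF assms(2)] by blast+
  moreover have "m \<noteq> c" using assms core_iff by metis
  ultimately show ?thesis
    using joinsD[OF assms(2)] assms(3) by (metis le_inf_iff order.antisym order.trans)
qed

text \<open>
  A congruence that identifies every \<open>inf a b\<close> with the join of \<open>a\<close> and \<open>b\<close> cannot have a block
  minimum in the core, and the congruence whose block minima are all other elements does make these
  identifications, by the preceding lemma.
\<close>

lemma tree_cong_eq: "tree_cong = same_below (- core :: 'a::{finite,semilattice_inf} set)"
proof
  let ?R = "{(inf a b, c) | a b c :: 'a.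
    a \<in> nonzero \<and> b \<in> nonzero \<and> incomparable a b \<and> is_join a b c}"
  have R: "?R = {(inf a b, c) | a b c. (a, b, c) \<in> joins}"
    using Inf_fin_UNIV_le by (fastforce simp: joins_def nonzero_def incomparable_def)
  have "?R \<subseteq> same_below (- core)"
    unfolding R same_below_def using outside_core_below_join joinsD(3)
    by (fastforce intro: order.trans)
  then show "tree_cong \<subseteq> same_below (- core :: 'a set)"
    unfolding tree_cong_def cong_generated_def using same_below_Con by blast
  have "same_below (- core) \<subseteq> \<theta>" if \<theta>: "\<theta> \<in> Con" "?R \<subseteq> \<theta>" for \<theta> :: "('a \<times> 'a) set"
  proof -
    have "x \<notin> core" if x: "x \<in> block_minima \<theta>" for x
    proof
      have below: False if j: "(a, b, c) \<in> joins" and "x \<le> c" "\<not> x \<le> inf a b" for a b c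
      proof -
        have "(c, inf a b) \<in> \<theta>" using \<theta> j ConD(2)[OF \<theta>(1)] unfolding R by blast
        then show False using block_minima_saturated[OF \<theta>(1) x] that by blast
      qed
      assume "x \<in> core"
      then show False
        unfolding core_iff
        using below joinsD(2,3) by (metis joinsD(1,4) le_inf_iff order.refl order.trans)
    qed
    then have "same_below (- core) \<subseteq> same_below (block_minima \<theta>)"
      by (intro same_below_antimono) auto
    then show ?thesis using same_below_block_minima[OF \<theta>(1)] by simp
  qed
  then show "same_below (- core :: 'a set) \<subseteq> tree_cong"
    unfolding tree_cong_def cong_generated_def by blast
qed

lemma tree_cong_Con: "tree_cong \<in> (Con :: ('a::{finite,semilattice_inf} \<times> 'a) set set)"
  by (simp add: tree_cong_eq same_below_Con)

lemma nonsingleton_block_iff: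
  "nonsingleton_block B \<longleftrightarrow> (\<exists>x y. x \<noteq> y \<and> (x, y) \<in> tree_cong \<and> B = tree_cong `` {x})"
proof -
  have "\<not> is_singleton (tree_cong `` {x :: 'a}) \<longleftrightarrow> (\<exists>y. x \<noteq> y \<and> (x, y) \<in> tree_cong)" for x
    using ConD(1)[OF tree_cong_Con, of x] by (auto simp: is_singleton_def set_eq_iff) metis+
  then show ?thesis unfolding nonsingleton_block_def quotient_def by fastforce
qed

lemma block_eq: "(x, y) \<in> tree_cong \<Longrightarrow> tree_cong `` {x} = tree_cong `` {y}"
  using ConD(2,3)[OF tree_cong_Con] by blast

text \<open>
  The equation between the \<open>joins\<close> of the two semilattices is what makes the embedded copy the
  nucleus: it transports the joins inside the copy and says that there are no others.
\<close>

definition joins_embedding :: "('b::semilattice_inf \<Rightarrow> 'a::semilattice_inf) \<Rightarrow> bool" where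
  "joins_embedding g \<longleftrightarrow> inj g \<and> (\<forall>x y. g (inf x y) = inf (g x) (g y)) \<and>
     joins = (\<lambda>(x, y, z). (g x, g y, g z)) ` joins"

lemma joins_embeddingI:
  assumes "inj g" "\<And>x y. g (inf x y) = inf (g x) (g y)"
    "joins = (\<lambda>(x, y, z). (g x, g y, g z)) ` joins"
  shows "joins_embedding g"
  using assms by (simp add: joins_embedding_def)

lemma joins_embeddingD:
  assumes "joins_embedding g"
  shows "joins = (\<lambda>(x, y, z). (g x, g y, g z)) ` joins" "g x = g y \<longleftrightarrow> x = y"
  using assms by (auto simp: joins_embedding_def dest: injD)

text \<open>
  For a bounded pair, the interval from its meet to its join lies in one block of the tree
  congruence, which is not a singleton and so must be the nucleus.  Thus all bounded pairs and their
  joins live in the nucleus, and an isomorphism identifies them with those of the target.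
\<close>

lemma joins_embedding_of_nucleus:
  assumes qt: "quasi_tree_semilattice TYPE('a::{finite,semilattice_inf})"
    and iso: "isomorphic_to (nucleus :: 'a set) TYPE('b::semilattice_inf)"
  shows "\<exists>g :: 'b \<Rightarrow> 'a. joins_embedding g"
proof -
  let ?B = "nucleus :: 'a set"
  have B: "C = ?B" if "nonsingleton_block C" for C
    using qt that unfolding quasi_tree_semilattice_def nucleus_def by (metis the_equality)
  obtain f :: "'a \<Rightarrow> 'b" where f: "bij_betw f ?B UNIV"
    and f_inf: "\<And>x y. x \<in> ?B \<Longrightarrow> y \<in> ?B \<Longrightarrow> f (inf x y) = inf (f x) (f y)"
    using iso unfolding isomorphic_to_def by blast
  have "nonsingleton_block ?B"
    using qt unfolding quasi_tree_semilattice_def nucleus_def by (rule theI')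
  then obtain b where b: "?B = tree_cong `` {b}"
    unfolding nonsingleton_block_iff by blast
  have B_inf: "inf x y \<in> ?B" if "x \<in> ?B" "y \<in> ?B" for x y
    using that ConD(4)[OF tree_cong_Con, of b x b y] unfolding b by simp
  have in_B: "a \<in> ?B \<and> b \<in> ?B \<and> c \<in> ?B" if j: "(a, b, c) \<in> joins" for a b c
  proof -
    have "x \<in> ?B" if "x \<in> {a, b, c}" for x
    proof -
      have *: "(inf a b, y) \<in> tree_cong" if "y \<in> {a, b, c}" for y
      proof -
        have "(inf a b, c) \<in> tree_cong"
          unfolding tree_cong_eq same_below_def
          using outside_core_below_join[OF _ j] joinsD(3)[OF j] by (fastforce intro: order.trans)
        then show ?thesis
          using ConD(4)[OF tree_cong_Con _ ConD(1)[OF tree_cong_Con], of "inf a b" c y]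
            that joinsD(3,4)[OF j]
          by (auto simp: inf_absorb1 inf_absorb2 inf_assoc inf_left_commute inf_commute)
      qed
      have "inf a b \<noteq> c"
        using joinsD[OF j] by (metis inf.cobounded1 order.antisym)
      then have "nonsingleton_block (tree_cong `` {inf a b})"
        unfolding nonsingleton_block_iff using * by blast
      then show ?thesis using B * that by blast
    qed
    then show ?thesis by blast
  qed
  have inj: "inj_on f ?B" using f by (simp add: bij_betw_def)
  have f_le: "f x \<le> f y \<longleftrightarrow> x \<le> y" if "x \<in> ?B" "y \<in> ?B" for x y
    using f_inf[OF that] B_inf[OF that] inj that by (metis inf.absorb_iff1 inj_onD)
  define g where "g = inv_into ?B f"
  have gB: "g x \<in> ?B" and fg: "f (g x) = x" for x
    using f unfolding g_def by (auto simp: bij_betw_def inv_into_into f_inv_into_f)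
  have gf: "g (f x) = x" if "x \<in> ?B" for x
    using inj that unfolding g_def by simp
  have g_le: "g x \<le> g y \<longleftrightarrow> x \<le> y" for x y
    using f_le[OF gB gB, of x y] by (simp add: fg)
  have "joins_embedding g"
    unfolding joins_embedding_def
  proof (intro conjI allI)
    show "inj g" by (metis fg injI)
    show "g (inf x y) = inf (g x) (g y)" for x y
      using f_inf[OF gB gB, of x y] gf[OF B_inf[OF gB gB], of x y] by (simp add: fg)
    have to: "(f a, f b, f c) \<in> joins" if j: "(a, b, c) \<in> joins" for a b c
    proof -
      have in_nuc: "a \<in> ?B" "b \<in> ?B" "c \<in> ?B" using in_B[OF j] by auto
      have "f c \<le> d" if "f a \<le> d" "f b \<le> d" for d
        using f_le[OF in_nuc(1) gB, of d] f_le[OF in_nuc(2) gB, of d] f_le[OF in_nuc(3) gB, of d]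
          joinsD(8)[OF j, of "g d"] that by (simp add: fg)
      then show ?thesis
        using joinsD[OF j] in_nuc by (simp add: joins_def incomparable_def is_join_def f_le)
    qed
    have joins_back: "(g a, g b, g c) \<in> joins" if j: "(a, b, c) \<in> joins" for a b c
    proof -
      have "\<not> g a \<le> g b" "\<not> g b \<le> g a" "g a \<le> g c" "g b \<le> g c"
        using joinsD[OF j] by (auto simp: g_le)
      then obtain d where d: "(g a, g b, d) \<in> joins" "d \<le> g c"
        using bounded_incomparable_join by blast
      then have "(a, b, f d) \<in> joins" using to[OF d(1)] by (simp add: fg)
      then have "c = f d" using j joins_unique by blast
      then show ?thesis using d in_B[OF d(1)] gf by simp
    qed
    show "joins = (\<lambda>(x, y, z). (g x, g y, g z)) ` joins"
    proof
      show "joins \<subseteq> (\<lambda>(x, y, z). (g x, g y, g z)) ` joins"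
      proof clarify
        fix a b c :: 'a assume j: "(a, b, c) \<in> joins"
        then have "(a, b, c) = (\<lambda>(x, y, z). (g x, g y, g z)) (f a, f b, f c)"
          using in_B gf by simp
        then show "(a, b, c) \<in> (\<lambda>(x, y, z). (g x, g y, g z)) ` joins"
          using to[OF j] by blast
      qed
    qed (use joins_back in auto)
  qed
  then show ?thesis by blast
qed

text \<open>
  The core of the embedded semilattice is everything but its least element \<open>u\<close>.  An element \<open>m\<close>
  outside the core of the large semilattice that is below some \<open>g x\<close> is therefore also below \<open>g u\<close>:
  as long as \<open>x\<close> is not \<open>u\<close>, it occurs in some join, and \<open>outside_core_below_join\<close> pushes \<open>m\<close> below
  the image of a meet that is strictly smaller than \<open>x\<close>.  Hence the whole image is one block, and
  every nonsingleton block meets the core and thus the image.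
\<close>

lemma nucleus_of_joins_embedding:
  fixes g :: "'b::{finite,semilattice_inf} \<Rightarrow> 'a::{finite,semilattice_inf}"
  assumes g: "joins_embedding g"
    and core: "\<And>x :: 'b. x \<in> core \<longleftrightarrow> x \<noteq> u" and ne: "w \<noteq> u"
  shows "quasi_tree_semilattice TYPE('a) \<and> isomorphic_to (nucleus :: 'a set) TYPE('b)"
proof -
  have inj: "inj g" and g_inf: "\<And>x y. g (inf x y) = inf (g x) (g y)"
    and J: "joins = (\<lambda>(x, y, z). (g x, g y, g z)) ` joins"
    using g unfolding joins_embedding_def by auto
  have joinsg: "(g x, g y, g z) \<in> joins" if "(x, y, z) \<in> joins" for x y z
    using that J by force
  have core_g: "core = g ` core"
    unfolding core_def by (subst J) auto
  have g_le: "g x \<le> g y \<longleftrightarrow> x \<le> y" for x y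
    using inj g_inf by (metis inf.absorb_iff1 injD)
  have gu: "g u \<notin> core"
    unfolding core_g using inj by (auto simp: core dest: injD)
  \<comment> \<open>The least element is never in the core, so it is the one exception \<open>u\<close>.\<close>
  have u_le: "u \<le> x" for x
  proof -
    have "Inf_fin UNIV \<notin> (core :: 'b set)"
      using zero_notin_joins unfolding core_iff by blast
    then have "Inf_fin UNIV = u" by (simp add: core)
    then show ?thesis using Inf_fin_UNIV_le[of x] by simp
  qed
  have below_u: "m \<le> g u" if "m \<notin> core" "m \<le> g x" for m x
    using that(2)
  proof (induction "card {y. y \<le> x}" arbitrary: x rule: less_induct)
    case less
    show ?case
    proof (cases "x = u")
      case True
      then show ?thesis using less by simp
    next
      case False
      then have "x \<in> core" by (simp add: core)
      then obtain a b c where j: "(a, b, c) \<in> joins" "x = a \<or> x = c"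
        unfolding core_iff by blast
      then have "m \<le> g c"
        using less.prems joinsD(3)[OF j(1)] g_le by (metis order.trans)
      then have m: "m \<le> g (inf a b)"
        using outside_core_below_join[OF that(1) joinsg[OF j(1)]] g_inf by simp
      have "inf a b \<le> x" "\<not> x \<le> inf a b"
        using joinsD[OF j(1)] j(2) by (auto intro: le_infI1 order.trans)
      then have "{y. y \<le> inf a b} \<subset> {y. y \<le> x}"
        using order.trans by blast
      then show ?thesis
        using less.hyps m by (metis finite psubset_card_mono)
    qed
  qed
  have eq_u: "(g x, g u) \<in> tree_cong" for x
    unfolding tree_cong_eq same_below_def using below_u u_le[of x] g_le
    by (auto intro: order.trans)
  have block_u: "tree_cong `` {g u} = range g"
  proof
    show "range g \<subseteq> tree_cong `` {g u}"
      using eq_u ConD(2)[OF tree_cong_Con] by blast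
    show "tree_cong `` {g u} \<subseteq> range g"
    proof clarify
      fix y assume y: "(g u, y) \<in> tree_cong"
      show "y \<in> range g"
      proof (cases "y \<in> core")
        case True
        then show ?thesis unfolding core_g by blast
      next
        case False
        then have "y \<le> g u" "g u \<le> y"
          using y gu unfolding tree_cong_eq same_below_def by auto
        then show ?thesis by (metis order.antisym rangeI)
      qed
    qed
  qed
  have block: "nonsingleton_block (range g)"
    unfolding nonsingleton_block_iff
    using ne inj eq_u[of w] ConD(2)[OF tree_cong_Con] block_u by (metis injD)
  have unique: "C = range g" if C: "nonsingleton_block C" for C
  proof -
    obtain x y where xy: "x \<noteq> y" "(x, y) \<in> tree_cong" "C = tree_cong `` {x}"
      using C unfolding nonsingleton_block_iff by blast
    have "x \<in> core \<or> y \<in> core"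
      using xy(1,2) unfolding tree_cong_eq same_below_def by (auto intro: order.antisym)
    then obtain z where "(x, g z) \<in> tree_cong"
      unfolding core_g using xy(2) ConD(1)[OF tree_cong_Con] by blast
    then show ?thesis
      using block_eq eq_u block_u xy(3) by metis
  qed
  have nuc: "nucleus = range g"
    unfolding nucleus_def using block unique by (rule the_equality)
  have "quasi_tree_semilattice TYPE('a)"
    unfolding quasi_tree_semilattice_def using block unique by blast
  moreover have "isomorphic_to (nucleus :: 'a set) TYPE('b)"
    unfolding isomorphic_to_def nuc
  proof (intro exI conjI ballI)
    show "bij_betw (inv g) (range g) UNIV" using inj by (rule inj_imp_bij_betw_inv)
    fix x y assume "x \<in> range g" "y \<in> range g"
    then show "inv g (inf x y) = inf (inv g x) (inv g y)"
      using inj by (auto simp flip: g_inf)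
  qed
  ultimately show ?thesis ..
qed


section \<open>The four named nuclei\<close>

text \<open>
  Finiteness of the named semilattices makes \<open>nucleus_of_joins_embedding\<close> applicable to them.
\<close>

instance bool4 :: finite
  by standard (rule finite_subset[of _ "{B4_u, B4_a, B4_b, B4_v}"], auto, metis bool4.exhaust)

instance pentagon :: finite
  by standard (rule finite_subset[of _ "{N5_u, N5_a, N5_b, N5_c, N5_v}"], auto, metis pentagon.exhaust)

instance hexagon :: finite
  by standard (rule finite_subset[of _ "{N6_u, N6_a1, N6_a2, N6_a3, N6_b, N6_v}"], auto,
    metis hexagon.exhaust)

instance semilattice_F :: finite
  by standard (rule finite_subset[of _ "{F_u, F_a, F_b, F_c, F_v1, F_v2}"], auto,
    metis semilattice_F.exhaust)

lemma joins_bool4: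
  "joins = {(B4_a, B4_b, B4_v), (B4_b, B4_a, B4_v)}"
proof
  have "(x, y, z) \<in> {(B4_a, B4_b, B4_v), (B4_b, B4_a, B4_v)}" if j: "(x, y, z) \<in> joins" for x y z
    using joinsD(1-4)[OF j] by (cases x; cases y; cases z; simp add: less_eq_bool4_iff)
  then show "joins \<subseteq> {(B4_a, B4_b, B4_v), (B4_b, B4_a, B4_v)}"
    unfolding subset_iff split_paired_All by blast
qed (auto simp: joins_def incomparable_def is_join_def less_eq_bool4_iff)

lemma joins_pentagon:
  "joins = {(N5_a, N5_b, N5_v), (N5_b, N5_a, N5_v), (N5_c, N5_b, N5_v), (N5_b, N5_c, N5_v)}" (is "_ = ?J")
proof
  have "(x, y, z) \<in> ?J" if j: "(x, y, z) \<in> joins" for x y z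
    using joinsD(1-4)[OF j] by (cases x; cases y; cases z; simp add: less_eq_pentagon_iff)
  then show "joins \<subseteq> ?J"
    unfolding subset_iff split_paired_All by blast
qed (auto simp: joins_def incomparable_def is_join_def less_eq_pentagon_iff)

lemma joins_hexagon:
  "joins = {(N6_a1, N6_b, N6_v), (N6_b, N6_a1, N6_v), (N6_a2, N6_b, N6_v), (N6_b, N6_a2, N6_v),
     (N6_a3, N6_b, N6_v), (N6_b, N6_a3, N6_v)}" (is "_ = ?J")
proof
  have "(x, y, z) \<in> ?J" if j: "(x, y, z) \<in> joins" for x y z
    using joinsD(1-4)[OF j] by (cases x; cases y; cases z; simp add: less_eq_hexagon_iff)
  then show "joins \<subseteq> ?J"
    unfolding subset_iff split_paired_All by blast
qed (auto simp: joins_def incomparable_def is_join_def less_eq_hexagon_iff)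

lemma joins_semilattice_F:
  "joins = {(F_a, F_b, F_v1), (F_b, F_a, F_v1), (F_c, F_b, F_v2), (F_b, F_c, F_v2)}" (is "_ = ?J")
proof
  have "(x, y, z) \<in> ?J" if j: "(x, y, z) \<in> joins" for x y z
    using joinsD(1-4)[OF j] by (cases x; cases y; cases z; simp add: less_eq_semilattice_F_iff)
  then show "joins \<subseteq> ?J"
    unfolding subset_iff split_paired_All by blast
qed (auto simp: joins_def incomparable_def is_join_def less_eq_semilattice_F_iff)

lemma core_named:
  "x \<in> core \<longleftrightarrow> x \<noteq> B4_u" "y \<in> core \<longleftrightarrow> y \<noteq> N5_u"
  "z \<in> core \<longleftrightarrow> z \<noteq> N6_u" "w \<in> core \<longleftrightarrow> w \<noteq> F_u"
  unfolding core_def joins_bool4 joins_pentagon joins_hexagon joins_semilattice_F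
  by (cases x, simp_all) (cases y, simp_all, cases z, simp_all, cases w, simp_all)

lemma share_tree:
  assumes "(joins :: ('a::{finite,semilattice_inf} \<times> 'a \<times> 'a) set) = {}"
  shows "share (join_closed :: 'a set \<Rightarrow> bool) = 1"
  using share_True[where 'a = 'a] by (simp add: join_closed_def[abs_def] assms)

lemma share_bool4:
  fixes g :: "bool4 \<Rightarrow> 'a::{finite,semilattice_inf}"
  assumes "joins_embedding g"
  shows "share (join_closed :: 'a set \<Rightarrow> bool) = 28 / 32"
  by (subst share_join_closed_eq[of "map g [B4_a, B4_b, B4_v]" "\<lambda>t. t!0 \<and> t!1 \<longrightarrow> t!2"])
    (auto simp: joins_embeddingD(2)[OF assms] join_closed_def
      joins_embeddingD(1)[OF assms, unfolded joins_bool4])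

lemma share_pentagon:
  fixes g :: "pentagon \<Rightarrow> 'a::{finite,semilattice_inf}"
  assumes "joins_embedding g"
  shows "share (join_closed :: 'a set \<Rightarrow> bool) = 26 / 32"
  by (subst share_join_closed_eq[of "map g [N5_a, N5_b, N5_c, N5_v]"
      "\<lambda>t. (t!0 \<and> t!1 \<longrightarrow> t!3) \<and> (t!2 \<and> t!1 \<longrightarrow> t!3)"])
    (auto simp: joins_embeddingD(2)[OF assms] join_closed_def
      joins_embeddingD(1)[OF assms, unfolded joins_pentagon])

lemma share_hexagon:
  fixes g :: "hexagon \<Rightarrow> 'a::{finite,semilattice_inf}"
  assumes "joins_embedding g"
  shows "share (join_closed :: 'a set \<Rightarrow> bool) = 25 / 32"
  by (subst share_join_closed_eq[of "map g [N6_a1, N6_a2, N6_a3, N6_b, N6_v]"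
      "\<lambda>t. (t!0 \<and> t!3 \<longrightarrow> t!4) \<and> (t!1 \<and> t!3 \<longrightarrow> t!4) \<and> (t!2 \<and> t!3 \<longrightarrow> t!4)"])
    (auto simp: joins_embeddingD(2)[OF assms] join_closed_def
      joins_embeddingD(1)[OF assms, unfolded joins_hexagon])

lemma share_semilattice_F:
  fixes g :: "semilattice_F \<Rightarrow> 'a::{finite,semilattice_inf}"
  assumes "joins_embedding g"
  shows "share (join_closed :: 'a set \<Rightarrow> bool) = 25 / 32"
  by (subst share_join_closed_eq[of "map g [F_a, F_b, F_c, F_v1, F_v2]"
      "\<lambda>t. (t!0 \<and> t!1 \<longrightarrow> t!3) \<and> (t!2 \<and> t!1 \<longrightarrow> t!4)"])
    (auto simp: joins_embeddingD(2)[OF assms] join_closed_def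
      joins_embeddingD(1)[OF assms, unfolded joins_semilattice_F])

lemma inf_neq_join:
  fixes a :: "'a::semilattice_inf"
  assumes "(a, b, v) \<in> joins"
  shows "inf a b \<noteq> a" "inf a b \<noteq> b" "inf a b \<noteq> v" "inf a b \<le> v"
proof -
  show "inf a b \<noteq> a" "inf a b \<noteq> b"
    using joinsD(1,2)[OF assms] inf.cobounded1[of a b] inf.cobounded2[of a b] by force+
  show "inf a b \<noteq> v" "inf a b \<le> v"
    using joinsD(1,4)[OF assms] joinsD(3)[OF assms] inf.cobounded2[of a b]
    by (fastforce, blast intro: le_infI1)
qed

text \<open>
  If \<open>b\<close> is minimal in the core, then the meet of one bounded pair with \<open>b\<close> is outside the core,
  being strictly below \<open>b\<close>, and lies below the join of the other, hence below its meet.  This forces the copies of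
  the named semilattices to have a single bottom element.
\<close>

lemma joins_share_inf:
  fixes b :: "'a::{finite,semilattice_inf}"
  assumes ab: "(a, b, v) \<in> joins" and cb: "(c, b, w) \<in> joins"
    and min: "\<And>x. x \<in> core \<Longrightarrow> x \<le> b \<Longrightarrow> x = b"
  shows "inf a b = inf c b"
proof -
  have "inf c b \<le> inf a b" if "(a, b, v) \<in> joins" "(c, b, w) \<in> joins" for a c v w
  proof (rule outside_core_below_join[OF _ that(1)])
    show "inf c b \<notin> core" using min inf_neq_join(2)[OF that(2)] by auto
    show "inf c b \<le> v" using joinsD(4)[OF that(1)] by (rule le_infI2)
  qed
  then show ?thesis using ab cb by (blast intro: order.antisym)
qed

lemma bool4_embedding:
  fixes a :: "'a::{finite,semilattice_inf}"
  assumes J: "joins = {(a, b, v), (b, a, v)}"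
  shows "\<exists>g :: bool4 \<Rightarrow> 'a. joins_embedding g"
proof
  let ?g = "\<lambda>x. case x of B4_u \<Rightarrow> inf a b | B4_a \<Rightarrow> a | B4_b \<Rightarrow> b | B4_v \<Rightarrow> v"
  have j: "(a, b, v) \<in> joins" by (simp add: J)
  show "joins_embedding ?g"
  proof (rule joins_embeddingI)
    show "inj ?g"
      using inf_neq_join[OF j] joinsD(5-7)[OF j] by (auto simp: inj_def split: bool4.split)
    show "?g (inf x y) = inf (?g x) (?g y)" for x y
      using inf_neq_join(4)[OF j] joinsD(3,4)[OF j]
      by (cases x; cases y; simp add: inf_bool4_def less_eq_bool4_iff inf_absorb1 inf_absorb2)
        (simp add: inf_commute)
  qed (simp add: J joins_bool4)
qed

lemma pentagon_embedding:
  fixes a :: "'a::{finite,semilattice_inf}"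
  assumes J: "joins = {(a, b, v), (b, a, v), (c, b, v), (b, c, v)}" and "a \<noteq> c" "a \<le> c"
  shows "\<exists>g :: pentagon \<Rightarrow> 'a. joins_embedding g"
proof
  let ?g = "\<lambda>x. case x of N5_u \<Rightarrow> inf a b | N5_a \<Rightarrow> a | N5_b \<Rightarrow> b | N5_c \<Rightarrow> c | N5_v \<Rightarrow> v"
  have ja: "(a, b, v) \<in> joins" and jc: "(c, b, v) \<in> joins" by (simp_all add: J)
  have cb: "inf c b = inf a b"
    by (rule joins_share_inf[OF jc ja])
      (use joinsD[OF ja] joinsD[OF jc] in \<open>auto simp: core_def J dest: order.antisym\<close>)
  note neq = inf_neq_join[OF ja] inf_neq_join[OF jc, unfolded cb]
  show "joins_embedding ?g"
  proof (rule joins_embeddingI)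
    show "inj ?g"
      using neq(1-3,5) joinsD(5-7)[OF ja] joinsD(5-7)[OF jc] \<open>a \<noteq> c\<close>
      by (auto simp: inj_def split: pentagon.split)
    have le: "a \<le> v" "b \<le> v" "c \<le> v" "inf a b \<le> v" "inf a b \<le> c"
      using joinsD(3,4)[OF ja] joinsD(3)[OF jc] \<open>a \<le> c\<close> neq(4) by (auto intro: le_infI1)
    show "?g (inf x y) = inf (?g x) (?g y)" for x y
      using le cb inf_commute[of b c] inf_commute[of b a] \<open>a \<le> c\<close>
      by (cases x; cases y;
          simp add: inf_pentagon_def less_eq_pentagon_iff inf_absorb1 inf_absorb2)
  qed (simp add: J joins_pentagon)
qed

lemma hexagon_embedding:
  fixes a :: "'a::{finite,semilattice_inf}"
  assumes J: "joins = {(a, b, v), (b, a, v), (c, b, v), (b, c, v), (d, b, v), (b, d, v)}"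
    and neq: "a \<noteq> c" "a \<noteq> d" "c \<noteq> d" and le: "a \<le> c" "c \<le> d"
  shows "\<exists>g :: hexagon \<Rightarrow> 'a. joins_embedding g"
proof
  let ?g = "\<lambda>x. case x of N6_u \<Rightarrow> inf a b | N6_a1 \<Rightarrow> a | N6_a2 \<Rightarrow> c | N6_a3 \<Rightarrow> d | N6_b \<Rightarrow> b | N6_v \<Rightarrow> v"
  have ja: "(a, b, v) \<in> joins" and jc: "(c, b, v) \<in> joins" and jd: "(d, b, v) \<in> joins"
    by (simp_all add: J)
  have min: "x = b" if "x \<in> core" "x \<le> b" for x
    using that joinsD[OF ja] joinsD[OF jc] joinsD[OF jd]
    by (auto simp: core_def J dest: order.antisym)
  have cb: "inf c b = inf a b" and db: "inf d b = inf a b"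
    using joins_share_inf[OF jc ja min] joins_share_inf[OF jd ja min] by blast+
  note inf_neq = inf_neq_join[OF ja] inf_neq_join(1)[OF jc, unfolded cb]
    inf_neq_join(1)[OF jd, unfolded db]
  show "joins_embedding ?g"
  proof (rule joins_embeddingI)
    show "inj ?g"
      using inf_neq(1-3,5,6) joinsD(5-7)[OF ja] joinsD(5-7)[OF jc] joinsD(5-7)[OF jd] neq
      by (auto simp: inj_def split: hexagon.split)
    have le': "a \<le> v" "b \<le> v" "c \<le> v" "d \<le> v" "inf a b \<le> v" "a \<le> d" "inf a b \<le> c" "inf a b \<le> d"
      using joinsD(3,4)[OF ja] joinsD(3)[OF jc] joinsD(3)[OF jd] le inf_neq(4)
      by (auto intro: le_infI1 order.trans)
    show "?g (inf x y) = inf (?g x) (?g y)" for x y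
      using le le' cb db inf_commute[of b c] inf_commute[of b a] inf_commute[of b d]
      by (cases x; cases y;
          simp add: inf_hexagon_def less_eq_hexagon_iff inf_absorb1 inf_absorb2)
  qed (simp add: J joins_hexagon)
qed

text \<open>
  With two joins \<open>v \<noteq> w\<close>, neither \<open>a \<le> w\<close> nor \<open>c \<le> v\<close> is possible, since \<open>a \<le> w\<close> would
  make \<open>v\<close> and \<open>c\<close> a third bounded pair.  Likewise \<open>inf v w\<close> and \<open>a\<close> would be a third one unless
  \<open>inf v w\<close> is \<open>b\<close>, and this value determines the remaining meets.
\<close>

lemma semilattice_F_embedding:
  fixes a :: "'a::{finite,semilattice_inf}"
  assumes J: "joins = {(a, b, v), (b, a, v), (c, b, w), (b, c, w)}" and "v \<noteq> w"
  shows "\<exists>g :: semilattice_F \<Rightarrow> 'a. joins_embedding g"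
proof
  let ?g = "\<lambda>x. case x of F_u \<Rightarrow> inf a b | F_a \<Rightarrow> a | F_b \<Rightarrow> b | F_c \<Rightarrow> c | F_v1 \<Rightarrow> v | F_v2 \<Rightarrow> w"
  have ja: "(a, b, v) \<in> joins" and jc: "(c, b, w) \<in> joins" by (simp_all add: J)
  have not_below: "\<not> a \<le> w"
    if J: "joins = {(a, b, v), (b, a, v), (c, b, w), (b, c, w)}" and "v \<noteq> w" for a c v w :: 'a
  proof
    assume "a \<le> w"
    have ja: "(a, b, v) \<in> joins" and jc: "(c, b, w) \<in> joins" by (simp_all add: J)
    have "v \<le> w" using joinsD(8)[OF ja \<open>a \<le> w\<close> joinsD(4)[OF jc]] .
    moreover have "(v, c, z) \<notin> joins" for z
      using joinsD(6,7)[OF ja] joinsD(5)[OF jc] by (auto simp: J)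
    ultimately have "v \<le> c \<or> c \<le> v"
      using bounded_comparable joinsD(3)[OF jc] by blast
    then show False
    proof
      assume "v \<le> c"
      then show False using joinsD(4)[OF ja] joinsD(2)[OF jc] by (blast intro: order.trans)
    next
      assume "c \<le> v"
      then have "w \<le> v" using joinsD(8)[OF jc _ joinsD(4)[OF ja]] by blast
      then show False using \<open>v \<le> w\<close> \<open>v \<noteq> w\<close> by (blast intro: order.antisym)
    qed
  qed
  have aw: "\<not> a \<le> w" using not_below[OF J \<open>v \<noteq> w\<close>] .
  have J': "joins = {(c, b, w), (b, c, w), (a, b, v), (b, a, v)}" unfolding J by auto
  have cv: "\<not> c \<le> v" using not_below[OF J' \<open>v \<noteq> w\<close>[symmetric]] .
  have cb: "inf c b = inf a b"
    by (rule joins_share_inf[OF jc ja])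
      (use joinsD[OF ja] joinsD[OF jc] in \<open>auto simp: core_def J dest: order.antisym\<close>)
  have vw: "inf v w = b"
  proof (rule ccontr)
    assume neq: "inf v w \<noteq> b"
    have "(inf v w, a, z) \<notin> joins" for z
      using neq joinsD(5)[OF ja] aw joinsD(3)[OF jc] by (auto simp: J)
    then have "inf v w \<le> a \<or> a \<le> inf v w"
      using bounded_comparable[of "inf v w" v a] joinsD(3)[OF ja] by auto
    moreover have "b \<le> inf v w" using joinsD(4)[OF ja] joinsD(4)[OF jc] by simp
    ultimately show False using aw joinsD(2)[OF ja] by (metis le_inf_iff order.trans)
  qed
  have a_w: "inf a w = inf a b"
    using inf_assoc[of a v w] inf_absorb1[OF joinsD(3)[OF ja]] by (simp add: vw)
  have c_v: "inf c v = inf a b"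
    using inf_assoc[of c w v] inf_absorb1[OF joinsD(3)[OF jc]] by (simp add: inf_commute[of w v] vw cb)
  have a_c: "inf a c = inf a b"
  proof (rule order.antisym)
    show "inf a c \<le> inf a b"
      using joinsD(3)[OF jc] unfolding a_w[symmetric] by (intro inf_mono) auto
    show "inf a b \<le> inf a c" by (metis cb inf.cobounded1 le_inf_iff)
  qed
  note neq = inf_neq_join[OF ja] inf_neq_join[OF jc, unfolded cb]
  show "joins_embedding ?g"
  proof (rule joins_embeddingI)
    show "inj ?g"
      using neq(1-3,5,7) joinsD(5-7)[OF ja] joinsD(5-7)[OF jc] joinsD(3)[OF ja] joinsD(3)[OF jc]
        aw cv \<open>v \<noteq> w\<close>
      by (auto simp: inj_def split: semilattice_F.split)
    note meets = cb vw a_w c_v a_c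
    have le: "a \<le> v" "b \<le> v" "c \<le> w" "b \<le> w" "inf a b \<le> v" "inf a b \<le> w" "inf a b \<le> c"
      using joinsD(3,4)[OF ja] joinsD(3,4)[OF jc] neq(4,8) by (auto simp flip: cb)
    show "?g (inf x y) = inf (?g x) (?g y)" for x y
      by (cases x; cases y;
          simp add: inf_semilattice_F_def less_eq_semilattice_F_iff doubleton_eq_iff
            inf_absorb1 inf_absorb2 le meets meets[THEN trans[OF inf_commute]] inf_commute[of b a])
  qed (simp add: J joins_semilattice_F)
qed


section \<open>Classification by the joins of incomparable pairs\<close>

text \<open>
  Two disjoint bounded pairs leave \<open>24/32\<close> if the join of one belongs to the other, and
  \<open>(7/8)^2 = 49/64\<close> if all six elements are distinct.  If the two joins are equal, the two pairs alone
  leave exactly \<open>25/32\<close>, but there is a further bounded pair across: otherwise both elements of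
  the first pair would be below both elements of the second, and so would their join.
\<close>

lemma disjoint_joins_share:
  fixes a :: "'a::{finite,semilattice_inf}"
  assumes ab: "(a, b, v) \<in> joins" and cd: "(c, d, w) \<in> joins" and disj: "{a, b} \<inter> {c, d} = {}"
  shows "share (join_closed :: 'a set \<Rightarrow> bool) < 25 / 32"
proof -
  \<comment> \<open>the join of one pair belongs to the other\<close>
  have feed: ?thesis
    if ab: "(a, b, v) \<in> joins" and vd: "(v, d, w) \<in> joins" and disj: "{a, b} \<inter> {v, d} = {}"
    for a b v d w :: 'a
  proof -
    have "w \<noteq> a" "w \<noteq> b"
      using joinsD(3,4,6,7)[OF ab] joinsD(3,6)[OF vd] by (auto dest: order.antisym)
    then have "distinct [a, b, v, d, w]"
      using joinsD(5-7)[OF ab] joinsD(5-7)[OF vd] disj by auto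
    then show ?thesis
      using share_join_closed_le[of "[a, b, v, d, w]" "\<lambda>t. (t!0 \<and> t!1 \<longrightarrow> t!2) \<and> (t!2 \<and> t!3 \<longrightarrow> t!4)"]
        join_closedD[OF _ ab] join_closedD[OF _ vd] by simp
  qed
  have same: ?thesis if vw: "v = w"
  proof -
    note cd = cd[folded vw]
    have "\<exists>p\<in>{a, b}. \<exists>q\<in>{c, d}. \<exists>r. (p, q, r) \<in> joins"
    proof (rule ccontr)
      assume *: "\<not> ?thesis"
      have comp: "p \<le> q \<or> q \<le> p" if "p \<in> {a, b}" "q \<in> {c, d}" for p q
        using bounded_comparable[of p v q] * that joinsD(3,4)[OF ab] joinsD(3,4)[OF cd] by blast
      have below: "p \<le> c \<and> p \<le> d \<or> c \<le> p \<and> d \<le> p" if "p \<in> {a, b}" for p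
        using comp[OF that, of c] comp[OF that, of d] joinsD(1,2)[OF cd] by (blast intro: order.trans)
      have "\<not> v \<le> p" if "p \<in> {a, b}" for p
        using that joinsD(1-4)[OF ab] by (blast intro: order.trans)
      then have "a \<le> c" "b \<le> c"
        using below[of a] below[of b] joinsD(8)[OF cd] by blast+
      then have "v \<le> c" using joinsD(8)[OF ab] by blast
      then show False using joinsD(3,6)[OF cd] by (simp add: order.antisym)
    qed
    then obtain p q r where pq: "(p, q, r) \<in> joins" "p \<in> {a, b}" "q \<in> {c, d}" by blast
    show ?thesis
      using share_join_closed_less[OF _ _ pq(1), of "[a, b, c, d, v]"
          "\<lambda>t. (t!0 \<and> t!1 \<longrightarrow> t!4) \<and> (t!2 \<and> t!3 \<longrightarrow> t!4)"]
        join_closedD[OF _ ab] join_closedD[OF _ cd] joinsD(5-7)[OF ab] joinsD(5-7)[OF cd] disj pq(2,3)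
      by auto
  qed
  have apart: ?thesis if "v \<noteq> w" "v \<notin> {c, d}" "w \<notin> {a, b}"
    using share_join_closed_le[of "[a, b, v, c, d, w]" "\<lambda>t. (t!0 \<and> t!1 \<longrightarrow> t!2) \<and> (t!3 \<and> t!4 \<longrightarrow> t!5)"]
      join_closedD[OF _ ab] join_closedD[OF _ cd] joinsD(5-7)[OF ab] joinsD(5-7)[OF cd] disj that
    by auto
  note ba = joins_commute[OF ab] and dc = joins_commute[OF cd]
  show ?thesis
    using same apart feed[of a b v d w] feed[of a b v c w] feed[of c d w a v] feed[of c d w b v]
      ab ba cd dc disj by blast
qed

text \<open>
  A star of two pairs with different joins, or of three pairs with the same join, already has the
  probability \<open>25/32\<close>; the extra pair \<open>{p, q}\<close> makes the difference.
\<close>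

lemma distinct_joins_share:
  fixes a :: "'a::{finite,semilattice_inf}"
  assumes ab: "(a, b, v) \<in> joins" and cb: "(c, b, w) \<in> joins" and "v \<noteq> w"
    and pq: "(p, q, r) \<in> joins" and new: "{p, q} \<noteq> {a, b}" "{p, q} \<noteq> {c, b}"
  shows "share (join_closed :: 'a set \<Rightarrow> bool) < 25 / 32"
proof -
  have "a \<noteq> c" using ab cb \<open>v \<noteq> w\<close> joins_unique by blast
  have "v \<noteq> c" "w \<noteq> a" using joinsD(4)[OF ab] joinsD(2)[OF cb] joinsD(4)[OF cb] joinsD(2)[OF ab] by auto
  then have dist: "distinct [a, b, c, v, w]"
    using joinsD(5-7)[OF ab] joinsD(5-7)[OF cb] \<open>a \<noteq> c\<close> \<open>v \<noteq> w\<close> by auto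
  have "\<not> {a, b} \<subseteq> {p, q}" "\<not> {c, b} \<subseteq> {p, q}"
    using new joinsD(5)[OF ab] joinsD(5)[OF cb] by auto
  then show ?thesis
    using share_join_closed_less[OF dist _ pq, of "\<lambda>t. (t!0 \<and> t!1 \<longrightarrow> t!3) \<and> (t!2 \<and> t!1 \<longrightarrow> t!4)"]
      join_closedD[OF _ ab] join_closedD[OF _ cb] by auto
qed

lemma four_joins_share:
  fixes a :: "'a::{finite,semilattice_inf}"
  assumes ab: "(a, b, v) \<in> joins" and cb: "(c, b, v) \<in> joins" and db: "(d, b, v) \<in> joins"
    and neq: "a \<noteq> c" "a \<noteq> d" "c \<noteq> d"
    and pq: "(p, q, r) \<in> joins" and new: "{p, q} \<noteq> {a, b}" "{p, q} \<noteq> {c, b}" "{p, q} \<noteq> {d, b}"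
  shows "share (join_closed :: 'a set \<Rightarrow> bool) < 25 / 32"
proof -
  have dist: "distinct [a, c, d, b, v]"
    using joinsD(5-7)[OF ab] joinsD(5-7)[OF cb] joinsD(5-7)[OF db] neq by auto
  have "\<not> {a, b} \<subseteq> {p, q}" "\<not> {c, b} \<subseteq> {p, q}" "\<not> {d, b} \<subseteq> {p, q}"
    using new joinsD(5)[OF ab] joinsD(5)[OF cb] joinsD(5)[OF db] by auto
  then show ?thesis
    using share_join_closed_less[OF dist _ pq,
        of "\<lambda>t. (t!0 \<and> t!3 \<longrightarrow> t!4) \<and> (t!1 \<and> t!3 \<longrightarrow> t!4) \<and> (t!2 \<and> t!3 \<longrightarrow> t!4)"]
      join_closedD[OF _ ab] join_closedD[OF _ cb] join_closedD[OF _ db] by auto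
qed

lemma triangle_share:
  fixes a :: "'a::{finite,semilattice_inf}"
  assumes ab: "(a, b, v) \<in> joins" and cb: "(c, b, v) \<in> joins" and ac: "(a, c, v) \<in> joins"
  shows "share (join_closed :: 'a set \<Rightarrow> bool) < 25 / 32"
proof -
  have dist: "distinct [a, b, c, v]"
    using joinsD(5-7)[OF ab] joinsD(5-7)[OF cb] joinsD(5-7)[OF ac] by auto
  show ?thesis
    using share_join_closed_le[OF dist,
        of "\<lambda>t. (t!0 \<and> t!1 \<longrightarrow> t!3) \<and> (t!2 \<and> t!1 \<longrightarrow> t!3) \<and> (t!0 \<and> t!2 \<longrightarrow> t!3)"]
      join_closedD[OF _ ab] join_closedD[OF _ cb] join_closedD[OF _ ac] by simp
qed

text \<open>
  Bounded pairs that pairwise intersect form a star or a triangle.  So once disjoint pairs are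
  excluded only stars remain, and these have at most three pairs, or two if the joins differ.
\<close>

lemma joins_shape:
  assumes share: "25 / 32 \<le> share (join_closed :: 'a::{finite,semilattice_inf} set \<Rightarrow> bool)"
  obtains "(joins :: ('a::{finite,semilattice_inf} \<times> 'a \<times> 'a) set) = {}"
  | a b v :: "'a::{finite,semilattice_inf}" where "joins = {(a, b, v), (b, a, v)}"
  | a b c v w :: "'a::{finite,semilattice_inf}" where "joins = {(a, b, v), (b, a, v), (c, b, w), (b, c, w)}" "a \<noteq> c"
  | a b c d v :: "'a::{finite,semilattice_inf}" where
      "joins = {(a, b, v), (b, a, v), (c, b, v), (b, c, v), (d, b, v), (b, d, v)}"
      "a \<noteq> c" "a \<noteq> d" "c \<noteq> d"
proof -
  have eqI: "joins = J"
    if "J \<subseteq> joins" "\<And>p q r. (p, q, r) \<in> joins \<Longrightarrow> \<exists>s. (p, q, s) \<in> J" for J :: "('a \<times> 'a \<times> 'a) set"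
    using that joins_unique by fast
  have meet: "a \<in> {c, d} \<or> b \<in> {c, d}" if "(a, b, v) \<in> joins" "(c, d, w) \<in> joins" for a b c d v w :: 'a
    using disjoint_joins_share[OF that] share by fastforce
  show thesis
  proof (cases "(joins :: ('a \<times> 'a \<times> 'a) set) = {}")
    case True
    then show ?thesis by (rule that(1))
  next
    case False
    then obtain a0 b0 v0 :: 'a where j0: "(a0, b0, v0) \<in> joins" by auto
    show ?thesis
    proof (cases "\<exists>p q r :: 'a. (p, q, r) \<in> joins \<and> {p, q} \<noteq> {a0, b0}")
      case False
      have "joins = {(a0, b0, v0), (b0, a0, v0)}"
      proof (rule eqI)
        show "{(a0, b0, v0), (b0, a0, v0)} \<subseteq> joins" using j0 joins_commute[OF j0] by simp
        fix p q r :: 'a assume "(p, q, r) \<in> joins"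
        then have "{p, q} = {a0, b0}" using False by blast
        then show "\<exists>s. (p, q, s) \<in> {(a0, b0, v0), (b0, a0, v0)}"
          by (auto simp: doubleton_eq_iff)
      qed
      then show ?thesis by (rule that(2))
    next
      case True
      then obtain p q r :: 'a where pq: "(p, q, r) \<in> joins" "{p, q} \<noteq> {a0, b0}" by blast
      have "\<exists>a b c v w. (a, b, v) \<in> joins \<and> (c, b, w) \<in> joins \<and> a \<noteq> (c :: 'a)"
        using meet[OF j0 pq(1)] pq j0 joins_commute[OF pq(1)] joins_commute[OF j0] by blast
      then obtain a b c v w :: 'a where ab: "(a, b, v) \<in> joins" and cb: "(c, b, w) \<in> joins"
        and "a \<noteq> c" by blast
      show ?thesis
      proof (cases "\<exists>p q r :: 'a. (p, q, r) \<in> joins \<and> {p, q} \<noteq> {a, b} \<and> {p, q} \<noteq> {c, b}")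
        case False
        have "joins = {(a, b, v), (b, a, v), (c, b, w), (b, c, w)}"
        proof (rule eqI)
          show "{(a, b, v), (b, a, v), (c, b, w), (b, c, w)} \<subseteq> joins"
            using ab joins_commute[OF ab] cb joins_commute[OF cb] by simp
          fix p q r :: 'a assume "(p, q, r) \<in> joins"
          then have "{p, q} = {a, b} \<or> {p, q} = {c, b}" using False by blast
          then show "\<exists>s. (p, q, s) \<in> {(a, b, v), (b, a, v), (c, b, w), (b, c, w)}"
            by (auto simp: doubleton_eq_iff)
        qed
        then show ?thesis using \<open>a \<noteq> c\<close> by (rule that(3))
      next
        case True
        then obtain p q r :: 'a where pq: "(p, q, r) \<in> joins" "{p, q} \<noteq> {a, b}" "{p, q} \<noteq> {c, b}"
          by blast
        have vw: "v = w" using distinct_joins_share[OF ab cb _ pq] share by fastforce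
        have "\<exists>d z. (d, b, z) \<in> joins \<and> d \<noteq> a \<and> d \<noteq> c \<or> (a, c, z) \<in> joins"
        proof (cases "b \<in> {p, q}")
          case True
          then obtain d where "(d, b, r) \<in> joins" "{p, q} = {d, b}"
            using pq(1) joins_commute[OF pq(1)] by blast
          then show ?thesis using pq(2,3) by metis
        next
          case False
          then have "p = a \<and> q = c \<or> p = c \<and> q = a"
            using meet[OF ab pq(1)] meet[OF cb pq(1)] \<open>a \<noteq> c\<close> by auto
          then have "(a, c, r) \<in> joins" using pq(1) joins_commute[OF pq(1)] by auto
          then show ?thesis by blast
        qed
        then consider d z where "(d, b, z) \<in> joins" "d \<noteq> a" "d \<noteq> c" | z where "(a, c, z) \<in> joins"
          by blast
        then show ?thesis
        proof cases
          case (1 d z)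
          have "v = z"
            using distinct_joins_share[OF ab 1(1) _ cb] share 1 \<open>a \<noteq> c\<close>
            by (fastforce simp: doubleton_eq_iff)
          with 1 have db: "(d, b, v) \<in> joins" by simp
          note cb = cb[folded vw]
          have "joins = {(a, b, v), (b, a, v), (c, b, v), (b, c, v), (d, b, v), (b, d, v)}"
          proof (rule eqI)
            fix p q r :: 'a assume pq: "(p, q, r) \<in> joins"
            have "{p, q} = {a, b} \<or> {p, q} = {c, b} \<or> {p, q} = {d, b}"
              using four_joins_share[OF ab cb db \<open>a \<noteq> c\<close> 1(2)[symmetric] 1(3)[symmetric] pq] share
              by linarith
            then show "\<exists>s. (p, q, s) \<in> {(a, b, v), (b, a, v), (c, b, v), (b, c, v), (d, b, v), (b, d, v)}"
              unfolding doubleton_eq_iff by blast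
          qed (use ab cb db ab[THEN joins_commute] cb[THEN joins_commute] db[THEN joins_commute] in simp)
          from that(4)[OF this \<open>a \<noteq> c\<close> 1(2)[symmetric] 1(3)[symmetric]] show ?thesis .
        next
          case (2 z)
          have "z = v"
            using distinct_joins_share[OF joins_commute[OF ab] joins_commute[OF 2] _ cb]
              share \<open>a \<noteq> c\<close> joinsD(5)[OF ab] joinsD(5)[OF cb] by (fastforce simp: doubleton_eq_iff)
          then show ?thesis
            using triangle_share[OF ab cb[folded vw]] 2 share by simp
        qed
      qed
    qed
  qed
qed

lemma share_classification:
  assumes share: "25 / 32 \<le> share (join_closed :: 'a::{finite,semilattice_inf} set \<Rightarrow> bool)"
  obtains "(joins :: ('a::{finite,semilattice_inf} \<times> 'a \<times> 'a) set) = {}"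
  | g :: "bool4 \<Rightarrow> 'a::{finite,semilattice_inf}" where "joins_embedding g"
  | g :: "pentagon \<Rightarrow> 'a::{finite,semilattice_inf}" where "joins_embedding g"
  | g :: "semilattice_F \<Rightarrow> 'a::{finite,semilattice_inf}" where "joins_embedding g"
  | g :: "hexagon \<Rightarrow> 'a::{finite,semilattice_inf}" where "joins_embedding g"
  using share
proof (cases rule: joins_shape)
  case 1
  then show ?thesis by (rule that(1))
next
  case (2 a b v)
  then show ?thesis using bool4_embedding that(2) by blast
next
  case (3 a b c v w)
  show ?thesis
  proof (cases "v = w")
    case True
    have ab: "(a, b, v) \<in> joins" and cb: "(c, b, v) \<in> joins" by (auto simp: 3(1) True)
    have "(a, c, z) \<notin> joins" for z using joinsD(5)[OF ab] joinsD(5)[OF cb] by (auto simp: 3(1))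
    with joinsD(3)[OF ab] joinsD(3)[OF cb] have "a \<le> c \<or> c \<le> a"
      by (rule bounded_comparable)
    then show ?thesis
    proof
      assume "a \<le> c"
      then show ?thesis using pentagon_embedding[OF 3(1)[folded True] 3(2)] that(3) by blast
    next
      assume "c \<le> a"
      have "joins = {(c, b, v), (b, c, v), (a, b, v), (b, a, v)}"
        unfolding 3(1) True by auto
      from pentagon_embedding[OF this 3(2)[symmetric] \<open>c \<le> a\<close>]
      show ?thesis using that(3) by blast
    qed
  next
    case False
    then show ?thesis using semilattice_F_embedding[OF 3(1)] that(4) by blast
  qed
next
  case (4 a b c d v)
  have emb: "\<exists>g :: hexagon \<Rightarrow> 'a. joins_embedding g"
    if "{p, q, r} = {a, c, d}" "p \<noteq> q" "p \<noteq> r" "q \<noteq> r" "p \<le> q" "q \<le> r" for p q r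
  proof -
    have "joins = (\<Union>x\<in>{p, q, r}. {(x, b, v), (b, x, v)})"
      unfolding that(1) 4(1) by auto
    also have "\<dots> = {(p, b, v), (b, p, v), (q, b, v), (b, q, v), (r, b, v), (b, r, v)}"
      by auto
    finally have "joins = {(p, b, v), (b, p, v), (q, b, v), (b, q, v), (r, b, v), (b, r, v)}" .
    from hexagon_embedding[OF this that(2-6)] show ?thesis .
  qed
  have comp: "x \<le> y \<or> y \<le> x" if "x \<in> {a, c, d}" "y \<in> {a, c, d}" for x y
  proof (rule bounded_comparable)
    have xb: "(x, b, v) \<in> joins" and yb: "(y, b, v) \<in> joins" using that by (auto simp: 4(1))
    show "x \<le> v" "y \<le> v" using joinsD(3) xb yb by blast+
    show "(x, y, z) \<notin> joins" for z using joinsD(5)[OF xb] joinsD(5)[OF yb] by (auto simp: 4(1))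
  qed
  have perms: "{a, d, c} = {a, c, d}" "{c, a, d} = {a, c, d}" "{c, d, a} = {a, c, d}"
    "{d, a, c} = {a, c, d}" "{d, c, a} = {a, c, d}" by auto
  have "\<exists>g :: hexagon \<Rightarrow> 'a. joins_embedding g"
  proof -
    have "a \<le> c \<or> c \<le> a" "a \<le> d \<or> d \<le> a" "c \<le> d \<or> d \<le> c"
      by (rule comp, simp, simp)+
    then show ?thesis
      using emb[OF refl 4(2,3,4)] emb[OF perms(1) 4(3,2) 4(4)[symmetric]]
        emb[OF perms(2) 4(2)[symmetric] 4(4,3)]
        emb[OF perms(3) 4(4) 4(2)[symmetric] 4(3)[symmetric]]
        emb[OF perms(4) 4(3)[symmetric] 4(4)[symmetric] 4(2)]
        emb[OF perms(5) 4(4)[symmetric] 4(3)[symmetric] 4(2)[symmetric]]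
      by argo
  qed
  then show ?thesis using that(5) by blast
qed

theorem theorem2p3:
  fixes n :: nat and con :: real
  assumes n: "n = card (UNIV :: 'a::{finite,semilattice_inf} set)" and "n > 1"
    and con: "con = real (card (Con :: ('a \<times> 'a) set set))"
  shows
    "(con \<le> 2 ^ (n - 1) \<and> (2::real) ^ (n - 1) = 32 * 2 powi (int n - 6) \<and>
     (con = 2 ^ (n - 1) \<longleftrightarrow> tree_semilattice TYPE('a))) \<and>
    ((con < 2 ^ (n - 1) \<longrightarrow> con \<le> 28 * 2 powi (int n - 6)) \<and>
     (con = 28 * 2 powi (int n - 6) \<longleftrightarrow>
        quasi_tree_semilattice TYPE('a) \<and> isomorphic_to (nucleus :: 'a set) TYPE(bool4))) \<and>
    ((con < 28 * 2 powi (int n - 6) \<longrightarrow> con \<le> 26 * 2 powi (int n - 6)) \<and>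
     (con = 26 * 2 powi (int n - 6) \<longleftrightarrow>
        quasi_tree_semilattice TYPE('a) \<and> isomorphic_to (nucleus :: 'a set) TYPE(pentagon))) \<and>
    ((con < 26 * 2 powi (int n - 6) \<longrightarrow> con \<le> 25 * 2 powi (int n - 6)) \<and>
     (con = 25 * 2 powi (int n - 6) \<longleftrightarrow>
        quasi_tree_semilattice TYPE('a) \<and>
        (isomorphic_to (nucleus :: 'a set) TYPE(semilattice_F) \<or>
         isomorphic_to (nucleus :: 'a set) TYPE(hexagon))))"
proof -
  define s where "s = share (join_closed :: 'a set \<Rightarrow> bool)"
  define q :: real where "q = 2 powi (int n - 6)"
  have q: "q > 0" by (simp add: q_def)
  have pow: "(2::real) ^ (n - 1) = 32 * q"
  proof -
    have "(2::real) ^ (n - 1) = 2 powi (5 + (int n - 6))"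
      using \<open>n > 1\<close> by (subst power_int_of_nat[symmetric]) (simp add: of_nat_diff)
    also have "\<dots> = 2 powi 5 * 2 powi (int n - 6)" by (rule power_int_add) simp
    finally show ?thesis by (simp add: q_def)
  qed
  have con_s: "con = 32 * s * q"
    using card_Con_share[where 'a = 'a] pow by (simp add: con n s_def)
  let ?tree = "tree_semilattice TYPE('a)"
  let ?B4 = "quasi_tree_semilattice TYPE('a) \<and> isomorphic_to (nucleus :: 'a set) TYPE(bool4)"
  let ?N5 = "quasi_tree_semilattice TYPE('a) \<and> isomorphic_to (nucleus :: 'a set) TYPE(pentagon)"
  let ?F = "quasi_tree_semilattice TYPE('a) \<and> isomorphic_to (nucleus :: 'a set) TYPE(semilattice_F)"
  let ?N6 = "quasi_tree_semilattice TYPE('a) \<and> isomorphic_to (nucleus :: 'a set) TYPE(hexagon)"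
  have tree: "s = 1" if ?tree
    using that share_tree[where 'a = 'a] by (simp add: s_def tree_semilattice_iff_no_joins)
  have B4: "s = 28 / 32" if ?B4
    using that joins_embedding_of_nucleus share_bool4 unfolding s_def by blast
  have N5: "s = 26 / 32" if ?N5
    using that joins_embedding_of_nucleus share_pentagon unfolding s_def by blast
  have F: "s = 25 / 32" if ?F
    using that joins_embedding_of_nucleus share_semilattice_F unfolding s_def by blast
  have N6: "s = 25 / 32" if ?N6
    using that joins_embedding_of_nucleus share_hexagon unfolding s_def by blast
  \<comment> \<open>The values \<open>32, 28, 26, 25\<close> are different, so this list of cases also yields the converses of
    the preceding implications.\<close>
  have cases: "s < 25 / 32 \<or> ?tree \<or> ?B4 \<or> ?N5 \<or> ?F \<or> ?N6"
  proof (cases "s < 25 / 32")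
    case False
    then have "25 / 32 \<le> share (join_closed :: 'a set \<Rightarrow> bool)" by (simp add: s_def)
    then show ?thesis
    proof (cases rule: share_classification)
      case 1
      then show ?thesis by (simp add: tree_semilattice_iff_no_joins)
    next
      case (2 g)
      then show ?thesis using nucleus_of_joins_embedding[OF 2 core_named(1), of B4_v] by simp
    next
      case (3 g)
      then show ?thesis using nucleus_of_joins_embedding[OF 3 core_named(2), of N5_v] by simp
    next
      case (4 g)
      then show ?thesis using nucleus_of_joins_embedding[OF 4 core_named(4), of F_v1] by simp
    next
      case (5 g)
      then show ?thesis using nucleus_of_joins_embedding[OF 5 core_named(3), of N6_v] by simp
    qed
  qed simp
  have con_iff: "con = k * q \<longleftrightarrow> s = k / 32" "con < k * q \<longleftrightarrow> s < k / 32" "con \<le> k * q \<longleftrightarrow> s \<le> k / 32" for k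
    using q by (auto simp: con_s field_simps)
  have range: "s < 25 / 32 \<or> s = 1 \<or> s = 28 / 32 \<or> s = 26 / 32 \<or> s = 25 / 32"
    using cases tree B4 N5 F N6 by blast
  have iffs: "?tree \<longleftrightarrow> s = 1" "?B4 \<longleftrightarrow> s = 28 / 32" "?N5 \<longleftrightarrow> s = 26 / 32"
    "quasi_tree_semilattice TYPE('a) \<and> (isomorphic_to (nucleus :: 'a set) TYPE(semilattice_F) \<or>
       isomorphic_to (nucleus :: 'a set) TYPE(hexagon)) \<longleftrightarrow> s = 25 / 32"
    using cases tree B4 N5 F N6 by auto
  show ?thesis
    unfolding pow q_def[symmetric] con_iff iffs using range by (elim disjE) simp_all
qed

end
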